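(* Let $k\in\mathbb R$ and let $X$ be a complete Alexandrov space with curvature $\geq k$. Let $p\in X$ and let $[qr]\subset X$ be a minimal geodesic, and let $\tilde p\in\mathbb S^2_k$ and $[\tilde q\tilde r]\subset\mathbb S^2_k$ be such that $|\tilde p\tilde q|=|pq|$, $|\tilde p\tilde r|=|pr|$, $|\tilde q\tilde r|=|qr|$. Suppose that $|pq|+|pr|+|qr|<\frac{2\pi}{\sqrt k}$ if $k>0$. Then for any $s\in[qr]$ and $\tilde s\in[\tilde q\tilde r]$ with $|qs|=|\tilde q\tilde s|$, we have $|ps|\ge|\tilde p\tilde s|$.
   Context: $\mathbb S^2_k$ is the complete simply connected $2$-dimensional Riemannian manifold of constant curvature $k$. $|xy|$ is the distance between $x$ and $y$, and $[xy]$ denotes a minimal geodesic (shortest path) between $x$ and $y$. An Alexandrov space with curvature $\ge k$ is a locally compact length space $X$ on which the Toponogov comparison holds locally: every point of $X$ has a neighborhood $U$ such that for any $p\in U$ and any minimal geodesic $[qr]\subset U$ (with $|pq|+|pr|+|qr|<\frac{2\pi}{\sqrt k}$ if $k>0$), and $\tilde p\in\mathbb S^2_k$, $[\tilde q\tilde r]\subset\mathbb S^2_k$ with $|\tilde p\tilde q|=|pq|$, $|\tilde p\tilde r|=|pr|$, $|\tilde q\tilde r|=|qr|$, one has $|ps|\ge|\tilde p\tilde s|$ for all $s\in[qr]$ and $\tilde s\in[\tilde q\tilde r]$ with $|qs|=|\tilde q\tilde s|$. *)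

theory Defs
  imports "HOL-Analysis.Analysis"
begin

text \<open>
  Metric spaces are pairs of a carrier \<open>M\<close> and a distance \<open>d\<close>, as in \<^locale>\<open>Metric_space\<close>,
  so that one set of definitions serves both for the space under consideration and for the
  model planes, whose carrier depends on the real number \<open>k\<close>.
\<close>

section \<open>Length spaces and minimal geodesics\<close>

definition curve_between ::
  "'a set \<Rightarrow> ('a \<Rightarrow> 'a \<Rightarrow> real) \<Rightarrow> 'a \<Rightarrow> 'a \<Rightarrow> (real \<Rightarrow> 'a) \<Rightarrow> bool" where
  "curve_between M d x y c \<longleftrightarrow>
     pathin (Metric_space.mtopology M d) c \<and> c 0 = x \<and> c 1 = y"

definition curve_length :: "('a \<Rightarrow> 'a \<Rightarrow> real) \<Rightarrow> (real \<Rightarrow> 'a) \<Rightarrow> ereal" where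
  "curve_length d c =
     (SUP (n, t) \<in> {(n::nat, t::nat \<Rightarrow> real). mono_on {..n} t \<and> t ` {..n} \<subseteq> {0..1}}.
        ereal (\<Sum>i<n. d (c (t i)) (c (t (Suc i)))))"

text \<open>
  The infimum over the empty set of curves is \<open>\<infinity>\<close>, so any two points of a length space
  are joined by a curve.
\<close>

definition length_space :: "'a set \<Rightarrow> ('a \<Rightarrow> 'a \<Rightarrow> real) \<Rightarrow> bool" where
  "length_space M d \<longleftrightarrow>
     Metric_space M d \<and>
     (\<forall>x\<in>M. \<forall>y\<in>M. ereal (d x y) = (INF c \<in> {c. curve_between M d x y c}. curve_length d c))"

definition minimal_geodesic ::
  "'a set \<Rightarrow> ('a \<Rightarrow> 'a \<Rightarrow> real) \<Rightarrow> 'a \<Rightarrow> 'a \<Rightarrow> 'a set \<Rightarrow> bool" where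
  "minimal_geodesic M d x y G \<longleftrightarrow>
     (\<exists>c. curve_between M d x y c \<and> curve_length d c = ereal (d x y) \<and> G = c ` {0..1})"


section \<open>The model plane of constant curvature\<close>

text \<open>
  The simply connected complete surface of constant curvature \<open>k\<close> with its Riemannian distance:
  the round sphere of radius \<open>1 / sqrt k\<close> for \<open>k > 0\<close>, the Euclidean plane (as a coordinate plane
  in three-space) for \<open>k = 0\<close>, and for \<open>k < 0\<close> the upper sheet of the hyperboloid of radius
  \<open>1 / sqrt (- k)\<close> in Minkowski space. In the last case \<open>k * minkowski x y \<ge> 1\<close> on the carrier. Off the carrier
  the distance is set to zero, because \<^locale>\<open>Metric_space\<close> requires a distance to be
  nonnegative and symmetric on the whole type.
\<close>

definition minkowski :: "real^3 \<Rightarrow> real^3 \<Rightarrow> real" where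
  "minkowski x y = x $ 1 * y $ 1 + x $ 2 * y $ 2 - x $ 3 * y $ 3"

definition model_plane :: "real \<Rightarrow> (real^3) set" where
  "model_plane k =
     (if k > 0 then {x. x \<bullet> x = 1 / k}
      else if k = 0 then {x. x $ 3 = 0}
      else {x. minkowski x x = 1 / k \<and> x $ 3 > 0})"

definition model_dist :: "real \<Rightarrow> real^3 \<Rightarrow> real^3 \<Rightarrow> real" where
  "model_dist k x y =
     (if x \<notin> model_plane k \<or> y \<notin> model_plane k then 0
      else if k > 0 then arccos (k * (x \<bullet> y)) / sqrt k
      else if k = 0 then dist x y
      else arcosh (k * minkowski x y) / sqrt (- k))"


lemma model_gram_ineq:
  fixes u1 u2 u3 v1 v2 v3 w1 w2 w3 e k :: real
  defines "b \<equiv> \<lambda>x1 x2 x3 y1 y2 y3. k * (x1 * y1 + x2 * y2 + e * (x3 * y3))"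
  assumes "e * k \<ge> 0"
    and "b u1 u2 u3 u1 u2 u3 = 1" "b v1 v2 v3 v1 v2 v3 = 1" "b w1 w2 w3 w1 w2 w3 = 1"
  shows "(b u1 u2 u3 v1 v2 v3 * b v1 v2 v3 w1 w2 w3 - b u1 u2 u3 w1 w2 w3)\<^sup>2 \<le>
         (1 - (b u1 u2 u3 v1 v2 v3)\<^sup>2) * (1 - (b v1 v2 v3 w1 w2 w3)\<^sup>2)"
proof -
  have "(b u1 u2 u3 u1 u2 u3 * b v1 v2 v3 v1 v2 v3 - (b u1 u2 u3 v1 v2 v3)\<^sup>2) *
        (b v1 v2 v3 v1 v2 v3 * b w1 w2 w3 w1 w2 w3 - (b v1 v2 v3 w1 w2 w3)\<^sup>2) -
        (b u1 u2 u3 v1 v2 v3 * b v1 v2 v3 w1 w2 w3 - b v1 v2 v3 v1 v2 v3 * b u1 u2 u3 w1 w2 w3)\<^sup>2 =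
        b v1 v2 v3 v1 v2 v3 * ((e * k) * (k *
        (u1 * (v2 * w3 - v3 * w2) - u2 * (v1 * w3 - v3 * w1) + u3 * (v1 * w2 - v2 * w1)))\<^sup>2)"
    unfolding b_def by algebra
  moreover have "0 \<le> (e * k) * (k *
        (u1 * (v2 * w3 - v3 * w2) - u2 * (v1 * w3 - v3 * w1) + u3 * (v1 * w2 - v2 * w1)))\<^sup>2"
    using assms(2) by simp
  ultimately show ?thesis
    using assms(3-5) by simp
qed

lemma arccos_triangle:
  fixes A B C :: real
  assumes "\<bar>A\<bar> \<le> 1" "\<bar>B\<bar> \<le> 1" "\<bar>C\<bar> \<le> 1"
    and le: "(A * B - C)\<^sup>2 \<le> (1 - A\<^sup>2) * (1 - B\<^sup>2)"
  shows "arccos C \<le> arccos A + arccos B"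
proof (cases "arccos A + arccos B \<le> pi")
  case True
  have "A * B - C \<le> sqrt ((1 - A\<^sup>2) * (1 - B\<^sup>2))"
    using le by (simp add: real_le_rsqrt)
  also have "\<dots> = sin (arccos A) * sin (arccos B)"
    using assms by (simp add: sin_arccos_abs real_sqrt_mult)
  finally have "cos (arccos A + arccos B) \<le> cos (arccos C)"
    using assms by (simp add: cos_add cos_arccos_abs)
  moreover have "0 \<le> arccos A + arccos B"
    using assms by (simp add: arccos_lbound abs_le_iff)
  ultimately show ?thesis
    using True assms by (subst (asm) cos_mono_le_eq) (auto simp: arccos_lbound arccos_ubound abs_le_iff)
next
  case False
  then show ?thesis
    using assms(3) arccos_ubound[of C] by (simp add: abs_le_iff)
qed

lemma arcosh_triangle:
  fixes A B C :: real
  assumes "1 \<le> A" "1 \<le> B" "1 \<le> C"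
    and le: "(A * B - C)\<^sup>2 \<le> (1 - A\<^sup>2) * (1 - B\<^sup>2)"
  shows "arcosh C \<le> arcosh A + arcosh B"
proof -
  have "(C - A * B)\<^sup>2 \<le> (A\<^sup>2 - 1) * (B\<^sup>2 - 1)"
    using le by (simp add: power2_commute algebra_simps)
  then have "C - A * B \<le> sqrt ((A\<^sup>2 - 1) * (B\<^sup>2 - 1))"
    by (rule real_le_rsqrt)
  also have "\<dots> = sinh (arcosh A) * sinh (arcosh B)"
    using assms by (simp add: sinh_arcosh_real real_sqrt_mult)
  finally have "cosh (arcosh C) \<le> cosh (arcosh A + arcosh B)"
    using assms by (simp add: cosh_add cosh_arcosh_real)
  then show ?thesis
    using assms by (subst (asm) cosh_real_nonneg_le_iff) (auto simp: arcosh_nonneg_real)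
qed

lemma minkowski_ge_1:
  assumes k: "k < 0" and "x \<in> model_plane k" "y \<in> model_plane k"
  shows "1 \<le> k * minkowski x y" and "k * minkowski x y = 1 \<longleftrightarrow> x = y"
proof -
  define a where "a = - 1 / k"
  have a: "a > 0" and ka: "k = - 1 / a" using k by (auto simp: a_def divide_neg_neg)
  have x: "(x$3)\<^sup>2 = a + (x$1)\<^sup>2 + (x$2)\<^sup>2" "x$3 > 0" 
    and y: "(y$3)\<^sup>2 = a + (y$1)\<^sup>2 + (y$2)\<^sup>2" "y$3 > 0"
    using assms by (auto simp: model_plane_def minkowski_def a_def power2_eq_square)
  define p where "p = x$1 * y$1 + x$2 * y$2 + a"
  have id: "(x$3 * y$3)\<^sup>2 - p\<^sup>2 =
      (x$1 * y$2 - x$2 * y$1)\<^sup>2 + a * ((x$1 - y$1)\<^sup>2 + (x$2 - y$2)\<^sup>2)"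
  proof -
    have "(x$3 * y$3)\<^sup>2 = (a + (x$1)\<^sup>2 + (x$2)\<^sup>2) * (a + (y$1)\<^sup>2 + (y$2)\<^sup>2)"
      by (simp only: power_mult_distrib x(1) y(1))
    then show ?thesis unfolding p_def by (simp only: power2_eq_square) (simp add: algebra_simps)
  qed
  have pos: "0 < x$3 * y$3" using x y by simp
  have "p\<^sup>2 \<le> (x$3 * y$3)\<^sup>2" 
  proof -
    have "0 \<le> (x$1 * y$2 - x$2 * y$1)\<^sup>2" by simp
    moreover have "0 \<le> a * ((x$1 - y$1)\<^sup>2 + (x$2 - y$2)\<^sup>2)" using a by simp
    ultimately show ?thesis using id by linarith
  qed
  then have le: "p \<le> x$3 * y$3" using pos by (meson less_imp_le power2_le_imp_le)
  have eq: "k * minkowski x y = 1 + (x$3 * y$3 - p) / a"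
    using a by (simp add: ka minkowski_def p_def field_simps)
  show "1 \<le> k * minkowski x y" using eq le a by simp
  show "k * minkowski x y = 1 \<longleftrightarrow> x = y"
  proof
    assume "k * minkowski x y = 1"
    then have "x$3 * y$3 = p" using eq a by simp
    then have "(x$1 * y$2 - x$2 * y$1)\<^sup>2 + a * ((x$1 - y$1)\<^sup>2 + (x$2 - y$2)\<^sup>2) = 0"
      using id by simp
    moreover have "0 \<le> (x$1 * y$2 - x$2 * y$1)\<^sup>2" by simp
    moreover have "0 \<le> a * ((x$1 - y$1)\<^sup>2 + (x$2 - y$2)\<^sup>2)" using a by simp
    ultimately have "a * ((x$1 - y$1)\<^sup>2 + (x$2 - y$2)\<^sup>2) = 0" by linarith
    then have 12: "x$1 = y$1" "x$2 = y$2" using a by (auto simp: sum_power2_eq_zero_iff)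
    then have "(x$3)\<^sup>2 = (y$3)\<^sup>2" using x y by simp
    then have "x$3 = y$3" using x(2) y(2) by (simp only: power2_eq_iff_nonneg less_imp_le)
    with 12 show "x = y" by (simp add: vec_eq_iff forall_3)
  next
    assume "x = y"
    then show "k * minkowski x y = 1"
      using assms by (simp add: model_plane_def)
  qed
qed

lemma sphere_le_1:
  assumes k: "k > 0" and "x \<in> model_plane k" "y \<in> model_plane k"
  shows "\<bar>k * (x \<bullet> y)\<bar> \<le> 1" and "k * (x \<bullet> y) = 1 \<longleftrightarrow> x = y"
proof -
  have x: "k * (x \<bullet> x) = 1" and y: "k * (y \<bullet> y) = 1"
    using assms by (auto simp: model_plane_def)
  have n: "k * ((x - y) \<bullet> (x - y)) = 2 - 2 * (k * (x \<bullet> y))"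
    "k * ((x + y) \<bullet> (x + y)) = 2 + 2 * (k * (x \<bullet> y))"
    using x y by (simp_all add: inner_simps inner_commute algebra_simps)
  have "0 \<le> k * ((x - y) \<bullet> (x - y))" "0 \<le> k * ((x + y) \<bullet> (x + y))"
    using k by simp_all
  then show "\<bar>k * (x \<bullet> y)\<bar> \<le> 1" using n by simp
  show "k * (x \<bullet> y) = 1 \<longleftrightarrow> x = y"
  proof
    assume "k * (x \<bullet> y) = 1"
    then show "x = y" using n(1) k by simp
  qed (use x in simp)
qed

lemma Metric_space_model_plane: "Metric_space (model_plane k) (model_dist k)"
proof (cases k "0::real" rule: linorder_cases)
  case less
  note ge = minkowski_ge_1[OF less]
  show ?thesis
  proof
    fix x y :: "real^3"
    show "0 \<le> model_dist k x y"
      using less ge by (auto simp: model_dist_def)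
    show "model_dist k x y = model_dist k y x"
      by (simp add: model_dist_def minkowski_def mult.commute dist_commute inner_commute)
  next
    fix x y assume xy: "x \<in> model_plane k" "y \<in> model_plane k"
    show "model_dist k x y = 0 \<longleftrightarrow> x = y"
      using less xy ge[OF xy] by (auto simp: model_dist_def)
  next
    fix x y z assume xyz: "x \<in> model_plane k" "y \<in> model_plane k" "z \<in> model_plane k"
    have "arcosh (k * minkowski x z) \<le> arcosh (k * minkowski x y) + arcosh (k * minkowski y z)"
      using ge xyz less model_gram_ineq[of "-1" k "x$1" "x$2" "x$3" "y$1" "y$2" "y$3" "z$1" "z$2" "z$3"]
      by (intro arcosh_triangle) (auto simp: minkowski_def model_plane_def)
    then show "model_dist k x z \<le> model_dist k x y + model_dist k y z"
      using less xyz by (simp add: model_dist_def divide_right_mono flip: add_divide_distrib)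
  qed
next
  case equal
  then show ?thesis
    by unfold_locales (auto simp: model_dist_def dist_commute dist_triangle)
next
  case greater
  note le = sphere_le_1[OF greater]
  show ?thesis
  proof
    fix x y :: "real^3"
    show "0 \<le> model_dist k x y"
      using greater le(1)[of x y] by (auto simp: model_dist_def abs_le_iff intro!: divide_nonneg_nonneg arccos_lbound)
    show "model_dist k x y = model_dist k y x"
      by (simp add: model_dist_def minkowski_def mult.commute dist_commute inner_commute)
  next
    fix x y assume xy: "x \<in> model_plane k" "y \<in> model_plane k"
    have "arccos (k * (x \<bullet> y)) = 0 \<longleftrightarrow> k * (x \<bullet> y) = 1"
      using cos_arccos_abs[OF le(1)[OF xy]] by (auto simp: arccos_1)
    then show "model_dist k x y = 0 \<longleftrightarrow> x = y"
      using greater xy le(2)[OF xy] by (simp add: model_dist_def)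
  next
    fix x y z assume xyz: "x \<in> model_plane k" "y \<in> model_plane k" "z \<in> model_plane k"
    have "arccos (k * (x \<bullet> z)) \<le> arccos (k * (x \<bullet> y)) + arccos (k * (y \<bullet> z))"
      using le(1) xyz greater model_gram_ineq[of 1 k "x$1" "x$2" "x$3" "y$1" "y$2" "y$3" "z$1" "z$2" "z$3"]
      by (intro arccos_triangle) (simp_all add: model_plane_def inner_vec_def sum_3)
    then show "model_dist k x z \<le> model_dist k x y + model_dist k y z"
      using greater xyz by (simp add: model_dist_def divide_right_mono flip: add_divide_distrib)
  qed
qed


section \<open>Alexandrov spaces\<close>

text \<open>
  Toponogov comparison for the point \<open>p\<close> and the minimal geodesic \<open>G\<close> from \<open>q\<close> to \<open>r\<close>.
  Comparison triangles exist and are unique up to isometry of the model plane whenever, for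
  \<open>k > 0\<close>, the perimeter is less than \<open>2 * pi / sqrt k\<close>.
\<close>

definition toponogov_comparison ::
  "real \<Rightarrow> ('a \<Rightarrow> 'a \<Rightarrow> real) \<Rightarrow> 'a \<Rightarrow> 'a \<Rightarrow> 'a \<Rightarrow> 'a set \<Rightarrow> bool" where
  "toponogov_comparison k d p q r G \<longleftrightarrow>
     (\<forall>p' q' r' G'.
        p' \<in> model_plane k \<and>
        minimal_geodesic (model_plane k) (model_dist k) q' r' G' \<and>
        model_dist k p' q' = d p q \<and> model_dist k p' r' = d p r \<and> model_dist k q' r' = d q r \<longrightarrow>
        (\<forall>s\<in>G. \<forall>s'\<in>G'. d q s = model_dist k q' s' \<longrightarrow> d p s \<ge> model_dist k p' s'))"

definition alexandrov_space :: "real \<Rightarrow> 'a set \<Rightarrow> ('a \<Rightarrow> 'a \<Rightarrow> real) \<Rightarrow> bool" where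
  "alexandrov_space k M d \<longleftrightarrow>
     length_space M d \<and>
     locally_compact_space (Metric_space.mtopology M d) \<and>
     (\<forall>x\<in>M. \<exists>V U. openin (Metric_space.mtopology M d) V \<and> x \<in> V \<and> V \<subseteq> U \<and> U \<subseteq> M \<and>
        (\<forall>p q r G.
           p \<in> U \<and> minimal_geodesic M d q r G \<and> G \<subseteq> U \<and>
           (k > 0 \<longrightarrow> d p q + d p r + d q r < 2 * pi / sqrt k) \<longrightarrow>
           toponogov_comparison k d p q r G))"

end

theory Submission
  imports Defs
begin

text \<open>
  Comparison is a local condition in the definition of an Alexandrov space, and the theorem says
  that it propagates to all scales. The argument has three layers.

  All curvatures are treated at once by the functions \<open>sn\<close>, \<open>cs\<close> and \<open>md\<close>, where \<open>md k\<close> is the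
  antiderivative of the generalised sine \<open>sn k\<close> that vanishes at 0. In the model plane the function
  \<open>f t = md k \<bar>p' c t\<bar>\<close> along a unit-speed geodesic \<open>c\<close> solves \<open>f'' + k f = 1\<close>. Comparison in
  \<open>X\<close> is therefore the statement that \<open>md k \<bar>p c t\<bar>\<close> is a supersolution, \<open>f'' + k f \<le> 1\<close>. Such a
  differential inequality needs to be checked only in a neighbourhood of each parameter \<open>t\<close>, but
  with \<open>p\<close> arbitrarily far away (\<open>md_dist_midpoint\<close>, \<open>midpoint_concave_nonneg\<close>,
  \<open>four_point_global\<close>).

  The local inequality follows from the hinge version of the comparison. A hinge is a pair of
  geodesics \<open>g\<close> and \<open>h\<close> from a common point. Local comparison makes its comparison angles monotone,
  so an angle exists, and the two angles that a geodesic \<open>h\<close> makes with the two directions of a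
  geodesic through its starting point have sum at most \<open>\<pi>\<close> (\<open>cos_angle_adjacent\<close>). Hinge comparison
  says that the end points of a hinge are at most as far apart as those of the hinge in the model
  plane with the same sides and the same angle; applied to the two hinges at \<open>c t\<close> with a short side
  along \<open>c\<close>, it bounds \<open>md k \<bar>p c (t - \<epsilon>)\<bar> + md k \<bar>p c (t + \<epsilon>)\<bar>\<close>.

  Hinge comparison itself is extended from hinges of size (sum of the two sides) less than
  \<open>2 / 3 * l\<close> to those of size less than \<open>l\<close> (\<open>hinges_compare_extend\<close>). Suppose it fails for
  a hinge at \<open>x\<close> with end points \<open>p\<close> and \<open>q\<close>, and let \<open>[xp]\<close> be the longer side. Slide the vertex along
  this side by \<open>l / 20\<close> to \<open>x'\<close>, and join \<open>x'\<close> to \<open>q\<close>. The two hinges formed with \<open>[xx']\<close> are short enough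
  to be compared, and Alexandrov's lemma (\<open>hinge_slide\<close>) shows that the third side predicted by the
  model for the hinge at \<open>x'\<close> is no longer than the prediction at \<open>x\<close>. So the new hinge fails as well.
  Its size is smaller by a definite amount (\<open>hinge_shrink\<close>): otherwise the angle at \<open>x\<close> is almost
  \<open>\<pi>\<close> or the side \<open>[xq]\<close> is negligible, so that the prediction is almost the size of the hinge, which
  is at least \<open>\<bar>pq\<bar>\<close>. Sizes cannot decrease by a definite amount forever.

  This needs geodesics between any two points and a scale at which comparison holds
  uniformly on a large ball. Both come from the Hopf-Rinow theorem (\<open>compact_mcball\<close>,
  \<open>geodesic_exists\<close>). Each extension step shrinks the ball of admissible vertices by \<open>2 * l\<close>, and
  these radii form a geometric series.
\<close>

section \<open>Trigonometric functions of constant curvature\<close>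

text \<open>The solution of \<open>f'' + k f = 0\<close> with \<open>f 0 = 0\<close> and \<open>f' 0 = 1\<close>.\<close>
definition sn :: "real \<Rightarrow> real \<Rightarrow> real" where
  "sn k t = (if k > 0 then sin (sqrt k * t) / sqrt k
             else if k = 0 then t else sinh (sqrt (- k) * t) / sqrt (- k))"

text \<open>The solution of \<open>f'' + k f = 0\<close> with \<open>f 0 = 1\<close> and \<open>f' 0 = 0\<close>.\<close>
definition cs :: "real \<Rightarrow> real \<Rightarrow> real" where
  "cs k t = (if k > 0 then cos (sqrt k * t)
             else if k = 0 then 1 else cosh (sqrt (- k) * t))"

text \<open>
  The solution of \<open>f'' + k f = 1\<close> with \<open>f 0 = 0\<close> and \<open>f' 0 = 0\<close>. Distances enter the law of cosines
  through this function, in a form that makes sense for all \<open>k\<close>.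
\<close>
definition md :: "real \<Rightarrow> real \<Rightarrow> real" where
  "md k t = (if k = 0 then t\<^sup>2 / 2 else (1 - cs k t) / k)"

text \<open>For \<open>k > 0\<close> the model plane has diameter \<open>\<pi> / sqrt k\<close>; for \<open>k \<le> 0\<close> it is unbounded.\<close>
definition below_diam :: "real \<Rightarrow> real \<Rightarrow> bool" where
  "below_diam k x \<longleftrightarrow> (k > 0 \<longrightarrow> x < pi / sqrt k)"

lemma below_diam_mono: "below_diam k y \<Longrightarrow> x \<le> y \<Longrightarrow> below_diam k x"
  unfolding below_diam_def by auto

lemma sn_0 [simp]: "sn k 0 = 0" and cs_0 [simp]: "cs k 0 = 1" and md_0 [simp]: "md k 0 = 0"
  and sn_minus [simp]: "sn k (- x) = - sn k x" and cs_minus [simp]: "cs k (- x) = cs k x"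
  and md_minus [simp]: "md k (- x) = md k x"
  by (auto simp: sn_def cs_def md_def)

lemma cs_eq: "cs k x = 1 - k * md k x"
  by (auto simp: md_def cs_def)

lemma cs_sn_square: "(cs k x)\<^sup>2 + k * (sn k x)\<^sup>2 = 1"
proof (cases k "0::real" rule: linorder_cases)
  case less
  then show ?thesis
    using cosh_square_eq[of "sqrt (-k) * x"] by (simp add: sn_def cs_def power_divide)
qed (auto simp: sn_def cs_def power_divide)

lemma sn_add: "sn k (x + y) = sn k x * cs k y + cs k x * sn k y"
  by (auto simp: sn_def cs_def distrib_left sin_add sinh_add add_divide_distrib)

lemma cs_add: "cs k (x + y) = cs k x * cs k y - k * (sn k x * sn k y)"
  by (auto simp: sn_def cs_def distrib_left cos_add cosh_add)

lemma md_add: "md k (x + y) = md k x + md k y * cs k x + sn k x * sn k y"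
proof (cases "k = 0")
  case True
  then show ?thesis by (simp add: md_def sn_def cs_def power2_eq_square field_simps)
next
  case False
  then show ?thesis
    by (simp add: md_def cs_add field_simps)
qed

lemma sn_diff: "sn k (x - y) = sn k x * cs k y - cs k x * sn k y"
  using sn_add[of k x "-y"] by simp

lemma cs_diff: "cs k (x - y) = cs k x * cs k y + k * (sn k x * sn k y)"
  using cs_add[of k x "-y"] by simp

lemma md_diff: "md k (x - y) = md k x + md k y * cs k x - sn k x * sn k y"
  using md_add[of k x "-y"] by simp

lemma sn_square: "(sn k x)\<^sup>2 = md k x * (1 + cs k x)"
proof (cases "k = 0")
  case False
  then show ?thesis using cs_sn_square[of k x] by (simp add: md_def power2_eq_square field_simps)
qed (simp add: md_def sn_def cs_def)

lemma DERIV_md: "(md k has_real_derivative sn k x) (at x)"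
proof (cases k "0::real" rule: linorder_cases)
  case less
  then have r: "sqrt (- k) * sqrt (- k) = - k" by simp
  have "((\<lambda>t. cosh (sqrt (- k) * t)) has_real_derivative sinh (sqrt (- k) * x) * sqrt (- k)) (at x)"
    by (auto intro!: derivative_eq_intros)
  from DERIV_cdivide[OF DERIV_diff[OF DERIV_const[of 1] this], of k]
  have "((\<lambda>t. (1 - cosh (sqrt (- k) * t)) / k) has_real_derivative sn k x) (at x)"
    by (rule DERIV_cong) (use less r in \<open>simp add: sn_def field_simps flip: mult.assoc\<close>)
  then show ?thesis using less by (simp add: md_def[abs_def] cs_def)
next
  case equal
  then show ?thesis
    by (auto simp: md_def[abs_def] sn_def intro!: derivative_eq_intros)
next
  case greater
  then have r: "sqrt k * sqrt k = k" by simp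
  have "((\<lambda>t. cos (sqrt k * t)) has_real_derivative - sin (sqrt k * x) * sqrt k) (at x)"
    by (auto intro!: derivative_eq_intros)
  from DERIV_cdivide[OF DERIV_diff[OF DERIV_const[of 1] this], of k]
  have "((\<lambda>t. (1 - cos (sqrt k * t)) / k) has_real_derivative sn k x) (at x)"
    by (rule DERIV_cong) (use greater r in \<open>simp add: sn_def field_simps\<close>)
  then show ?thesis using greater by (simp add: md_def[abs_def] cs_def)
qed

lemma isCont_md: "isCont (md k) x"
  using DERIV_md DERIV_isCont by blast

lemma isCont_sn: "isCont (sn k) x"
  by (cases k "0::real" rule: linorder_cases) (auto simp: sn_def[abs_def] intro!: continuous_intros)

lemma isCont_cs: "isCont (cs k) x"
  by (cases k "0::real" rule: linorder_cases) (auto simp: cs_def[abs_def] intro!: continuous_intros)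

lemma continuous_on_md [continuous_intros]: 
  "continuous_on A f \<Longrightarrow> continuous_on A (\<lambda>x. md k (f x))"
  using continuous_on_compose2[of UNIV "md k" A f] continuous_at_imp_continuous_on isCont_md by blast

lemma continuous_on_sn [continuous_intros]: 
  "continuous_on A f \<Longrightarrow> continuous_on A (\<lambda>x. sn k (f x))"
  using continuous_on_compose2[of UNIV "sn k" A f] continuous_at_imp_continuous_on isCont_sn by blast

lemma continuous_on_cs [continuous_intros]: 
  "continuous_on A f \<Longrightarrow> continuous_on A (\<lambda>x. cs k (f x))"
  using continuous_on_compose2[of UNIV "cs k" A f] continuous_at_imp_continuous_on isCont_cs by blast

lemma sn_pos:
  assumes "0 < x" "below_diam k x"
  shows "0 < sn k x"
proof (cases k "0::real" rule: linorder_cases)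
  case greater
  then have "sqrt k * x < pi" using assms by (simp add: below_diam_def field_simps)
  then show ?thesis using greater assms by (simp add: sn_def sin_gt_zero)
qed (use assms in \<open>auto simp: sn_def\<close>)

lemma sn_nonneg: "0 \<le> x \<Longrightarrow> below_diam k x \<Longrightarrow> 0 \<le> sn k x"
  using sn_pos[of x k] by (cases "x = 0") auto

text \<open>
  On an interval of length below the diameter, the cosine centred at the midpoint is a positive
  solution of \<open>f'' + k f = 0\<close>.
\<close>
lemma cs_half_pos:
  assumes "below_diam k L" "2 * \<bar>x\<bar> \<le> L"
  shows "0 < cs k x"
proof (cases k "0::real" rule: linorder_cases)
  case greater
  then have "sqrt k * L < pi" using assms by (simp add: below_diam_def field_simps)
  moreover have "sqrt k * (2 * \<bar>x\<bar>) \<le> sqrt k * L" 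
    using greater assms(2) by (intro mult_left_mono) auto
  ultimately have "sqrt k * (2 * \<bar>x\<bar>) < pi" by linarith
  then have "2 * \<bar>sqrt k * x\<bar> < pi" using greater by (simp add: abs_mult mult.left_commute)
  then show ?thesis using greater by (simp add: cs_def) (intro cos_gt_zero_pi, auto)
qed (auto simp: cs_def)

lemma md_strict_mono:
  assumes "0 \<le> x" "x < y" "k > 0 \<Longrightarrow> y \<le> pi / sqrt k"
  shows "md k x < md k y"
proof (rule DERIV_pos_imp_increasing_open[OF assms(2)])
  fix t assume t: "x < t" "t < y"
  then have "0 < sn k t" using assms by (intro sn_pos) (auto simp: below_diam_def)
  then show "\<exists>D. (md k has_real_derivative D) (at t) \<and> 0 < D" using DERIV_md by blast
qed (auto intro!: continuous_intros)

lemma md_mono: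
  assumes "0 \<le> x" "x \<le> y" "k > 0 \<Longrightarrow> y \<le> pi / sqrt k"
  shows "md k x \<le> md k y"
  using md_strict_mono[of x y k] assms by (cases "x = y") auto

lemma md_inj:
  assumes "md k x = md k y" "0 \<le> x" "0 \<le> y"
   "k > 0 \<Longrightarrow> x \<le> pi / sqrt k" "k > 0 \<Longrightarrow> y \<le> pi / sqrt k"
  shows "x = y"
  using md_strict_mono[of x y k] md_strict_mono[of y x k] assms by (cases x y rule: linorder_cases) auto

lemma md_abs: "md k \<bar>x\<bar> = md k x" by (cases "x \<ge> 0") auto

section \<open>Law of cosines\<close>

text \<open>
  The law of cosines: \<open>md k\<close> of the third side of a model triangle whose other sides \<open>a\<close> and \<open>b\<close>
  enclose an angle with cosine \<open>c\<close>. It is affine in \<open>c\<close>, and it is \<open>md k (a - b)\<close> for \<open>c = 1\<close> and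
  \<open>md k (a + b)\<close> for \<open>c = -1\<close>.
\<close>
definition third_side :: "real \<Rightarrow> real \<Rightarrow> real \<Rightarrow> real \<Rightarrow> real" where
  "third_side k a b c = md k a + md k b * cs k a - sn k a * sn k b * c"

text \<open>
  The cosine of the comparison angle: the angle between the sides \<open>a\<close> and \<open>b\<close> of a model triangle with
  third side \<open>e\<close>.
\<close>
definition cos_cmp :: "real \<Rightarrow> real \<Rightarrow> real \<Rightarrow> real \<Rightarrow> real" where
  "cos_cmp k a b e = (md k a + md k b * cs k a - md k e) / (sn k a * sn k b)"

lemma third_side_commute: "third_side k a b c = third_side k b a c"
  by (simp add: third_side_def cs_eq algebra_simps)

lemma cos_cmp_commute: "cos_cmp k a b e = cos_cmp k b a e"
  by (simp add: cos_cmp_def cs_eq algebra_simps)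

lemma third_side_cos_cmp: 
  assumes "0 < a" "0 < b" "below_diam k a" "below_diam k b"
  shows "third_side k a b (cos_cmp k a b e) = md k e"
  using sn_pos[of a k] sn_pos[of b k] assms by (simp add: third_side_def cos_cmp_def)

lemma md_le_third_side_iff:
  assumes "0 < a" "0 < b" "below_diam k a" "below_diam k b"
  shows "md k e \<le> third_side k a b c \<longleftrightarrow> c \<le> cos_cmp k a b e"
  using sn_pos[of a k] sn_pos[of b k] assms by (simp add: third_side_def cos_cmp_def field_simps)

lemma third_side_le_md_iff:
  assumes "0 < a" "0 < b" "below_diam k a" "below_diam k b"
  shows "third_side k a b c \<le> md k e \<longleftrightarrow> cos_cmp k a b e \<le> c"
  using sn_pos[of a k] sn_pos[of b k] assms by (simp add: third_side_def cos_cmp_def field_simps)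

lemma third_side_antimono:
  assumes "0 \<le> a" "0 \<le> b" "below_diam k a" "below_diam k b" "c \<le> c'"
  shows "third_side k a b c' \<le> third_side k a b c"
  using sn_nonneg[of a k] sn_nonneg[of b k] assms by (simp add: third_side_def mult_left_mono)

lemma third_side_eq_add: "third_side k a b c = md k (a + b) - sn k a * sn k b * (1 + c)"
  by (simp add: third_side_def md_add algebra_simps)

lemma third_side_eq_diff: "third_side k a b c = md k (a - b) + sn k a * sn k b * (1 - c)"
  by (simp add: third_side_def md_diff algebra_simps)

lemma cos_cmp_bounds:
  assumes "0 < a" "0 < b" "below_diam k (a + b)" "\<bar>a - b\<bar> \<le> e" "e \<le> a + b"
  shows "-1 \<le> cos_cmp k a b e" "cos_cmp k a b e \<le> 1"
proof -
  have ok: "below_diam k a" "below_diam k b" using assms below_diam_mono by force+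
  have le: "md k e \<le> md k (a + b)"
    using assms by (intro md_mono) (auto simp: below_diam_def)
  have ge: "md k \<bar>a - b\<bar> \<le> md k e"
    using assms by (intro md_mono) (auto simp: below_diam_def)
  have "md k e \<le> third_side k a b (-1)" using le by (simp add: third_side_eq_add)
  then show "-1 \<le> cos_cmp k a b e" using md_le_third_side_iff ok assms by blast
  have p: "0 < sn k a * sn k b" using sn_pos ok assms by simp
  have "third_side k a b 1 \<le> third_side k a b (cos_cmp k a b e)"
    using ge ok assms by (subst third_side_cos_cmp) (auto simp: third_side_eq_diff md_abs)
  then have "sn k a * sn k b * cos_cmp k a b e \<le> sn k a * sn k b * 1" 
    unfolding third_side_def by simp
  then show "cos_cmp k a b e \<le> 1" using mult_le_cancel_left_pos[OF p] by blast
qed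

text \<open>
  Take a model triangle with sides \<open>t\<close>, \<open>b\<close> and \<open>e\<close>, and prolong the side \<open>t\<close> by \<open>u\<close> beyond the vertex
  opposite to \<open>b\<close>. The distance from the new end point to the vertex opposite to \<open>t\<close> can be computed
  from the hinge with sides \<open>t + u\<close> and \<open>b\<close>, or from the hinge with sides \<open>u\<close> and \<open>e\<close>, whose
  angle is supplementary. This is the model part of Alexandrov's lemma.
\<close>
lemma third_side_extend:
  assumes "0 < t" "0 < b" "0 < e" "below_diam k t" "below_diam k b" "below_diam k e"
  shows "third_side k u e (- cos_cmp k t e b) = third_side k (t + u) b (cos_cmp k t b e)"
proof -
  have p: "sn k t > 0" "sn k b > 0" "sn k e > 0" using assms sn_pos by auto
  have e1: "sn k t * third_side k u e (- cos_cmp k t e b) =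
      sn k t * (md k u + md k e * cs k u) + sn k u * (md k t + md k e * cs k t - md k b)"
    using p by (simp add: third_side_def cos_cmp_def field_simps)
  have e2: "sn k t * third_side k (t + u) b (cos_cmp k t b e) =
      sn k t * (md k (t + u) + md k b * cs k (t + u)) - sn k (t + u) * (md k t + md k b * cs k t - md k e)"
    using p by (simp add: third_side_def cos_cmp_def field_simps)
  have "sn k t * third_side k u e (- cos_cmp k t e b) = sn k t * third_side k (t + u) b (cos_cmp k t b e)"
    unfolding e1 e2 using cs_eq[of k t] cs_eq[of k u] sn_square[of k t] sn_square[of k u]
    unfolding sn_add cs_add md_add by algebra
  then show ?thesis using p by simp
qed

text \<open>
  Stewart's theorem. In the model triangle with base \<open>t + u\<close> and sides \<open>A\<close> and \<open>B\<close>, the left-hand side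
  measures the distance from the apex to the point that divides the base into \<open>t\<close> and \<open>u\<close>. The
  right-hand side is free of angles, and it is meaningful for degenerate triangles with \<open>A = 0\<close> too
  (\<open>four_point_degenerate\<close>).
\<close>
lemma four_point_third_side:
  assumes "0 < t + u" "0 < A" "below_diam k (t + u)" "below_diam k A"
  shows "sn k (t + u) * third_side k t A (cos_cmp k (t + u) A B) =
    sn k u * (md k A - md k t) + sn k t * (md k B - md k u)"
proof -
  have p: "sn k (t + u) > 0" "sn k A > 0" using assms sn_pos by auto
  have e: "sn k (t + u) * third_side k t A (cos_cmp k (t + u) A B) =
     sn k (t + u) * (md k t + md k A * cs k t) - sn k t * (md k (t + u) + md k A * cs k (t + u) - md k B)"
    using p by (simp add: third_side_def cos_cmp_def field_simps)
  show ?thesis unfolding e using cs_eq[of k t] cs_eq[of k u] sn_square[of k t] sn_square[of k u]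
    unfolding sn_add cs_add md_add by algebra
qed

lemma four_point_degenerate:
  "sn k (t + u) * md k t = sn k u * (md k 0 - md k t) + sn k t * (md k (t + u) - md k u)"
  using cs_eq[of k t] cs_eq[of k u] sn_square[of k t] sn_square[of k u]
  unfolding sn_add cs_add md_add md_0 by algebra

section \<open>Unit-speed geodesics\<close>

definition geod :: "'a set \<Rightarrow> ('a \<Rightarrow> 'a \<Rightarrow> real) \<Rightarrow> (real \<Rightarrow> 'a) \<Rightarrow> real \<Rightarrow> bool" where
  "geod M d g a \<longleftrightarrow> (\<forall>s\<in>{0..a}. g s \<in> M) \<and> (\<forall>s\<in>{0..a}. \<forall>t\<in>{0..a}. d (g s) (g t) = \<bar>s - t\<bar>)"

lemma geod_in: "geod M d g a \<Longrightarrow> 0 \<le> s \<Longrightarrow> s \<le> a \<Longrightarrow> g s \<in> M"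
  and geod_dist: "geod M d g a \<Longrightarrow> 0 \<le> s \<Longrightarrow> s \<le> a \<Longrightarrow> 0 \<le> t \<Longrightarrow> t \<le> a \<Longrightarrow> d (g s) (g t) = \<bar>s - t\<bar>"
  by (simp_all add: geod_def)

lemma geod_mono: "geod M d g a \<Longrightarrow> b \<le> a \<Longrightarrow> geod M d g b"
  by (auto simp: geod_def)

lemma geod_shift: "geod M d g a \<Longrightarrow> 0 \<le> c \<Longrightarrow> c + b \<le> a \<Longrightarrow> geod M d (\<lambda>t. g (c + t)) b"
  by (auto simp: geod_def)

lemma geod_reverse: "geod M d g a \<Longrightarrow> c \<le> a \<Longrightarrow> geod M d (\<lambda>t. g (c - t)) c"
  by (auto simp: geod_def abs_minus_commute)

text \<open>
  Since the total length equals the distance of the end points, the triangle inequality is an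
  equality for any two points on the two pieces.
\<close>
lemma (in Metric_space) geod_append:
  assumes g: "geod M d g a" and h: "geod M d h b" and ab: "0 \<le> a" "0 \<le> b"
    and join: "g a = h 0" and len: "d (g 0) (h b) = a + b"
  shows "geod M d (\<lambda>t. if t \<le> a then g t else h (t - a)) (a + b)"
proof -
  have cross: "d (g s) (h (t - a)) = t - s" if "0 \<le> s" "s \<le> a" "a \<le> t" "t \<le> a + b" for s t
  proof -
    have M: "g s \<in> M" "g a \<in> M" "h (t - a) \<in> M" "g 0 \<in> M" "h b \<in> M" "h 0 \<in> M"
      using that g h ab by (auto simp: geod_def)
    have "d (g s) (h (t - a)) \<le> d (g s) (g a) + d (h 0) (h (t - a))"
      using triangle[of "g s" "g a" "h (t - a)"] M join by simp
    moreover have "d (g 0) (h b) \<le> d (g 0) (g s) + d (g s) (h (t - a)) + d (h (t - a)) (h b)"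
      using triangle[of "g 0" "g s" "h b"] triangle[of "g s" "h (t - a)" "h b"] M by simp
    ultimately show ?thesis
      using that ab len geod_dist[OF g, of s a] geod_dist[OF g, of 0 s] 
        geod_dist[OF h, of 0 "t - a"] geod_dist[OF h, of "t - a" b] by simp
  qed
  show ?thesis
    unfolding geod_def
  proof (intro conjI ballI)
    fix s t assume st: "s \<in> {0..a + b}" "t \<in> {0..a + b}"
    show "d (if s \<le> a then g s else h (s - a)) (if t \<le> a then g t else h (t - a)) = \<bar>s - t\<bar>"
      using st cross[of s t] cross[of t s] geod_dist[OF g, of s t] geod_dist[OF h, of "s - a" "t - a"]
      by (auto simp: commute)
  qed (use g h in \<open>auto simp: geod_def\<close>)
qed

lemma (in Metric_space) curve_length_ge:
  assumes "0 \<le> u" "u \<le> 1"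
  shows "ereal (d (c 0) (c u) + d (c u) (c 1)) \<le> curve_length d c"
proof -
  define t :: "nat \<Rightarrow> real" where "t i = (if i = 0 then 0 else if i = 1 then u else 1)" for i
  have "mono_on {..2} t" "t ` {..2} \<subseteq> {0..1}"
    using assms by (auto simp: mono_on_def t_def)
  then have "ereal (\<Sum>i<2. d (c (t i)) (c (t (Suc i)))) \<le> curve_length d c"
    unfolding curve_length_def by (intro SUP_upper2[of "(2, t)"]) auto
  then show ?thesis by (simp add: t_def numeral_2_eq_2)
qed

text \<open>
  A point \<open>z\<close> with these distances lies on a unit-speed geodesic, made of geodesics \<open>[xz]\<close> and \<open>[zy]\<close>
  joined at \<open>z\<close>. Such a geodesic can take the place of the given curve.
\<close>
lemma minimal_geodesic_between:
  assumes "Metric_space M d" "minimal_geodesic M d x y G" "z \<in> G"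
  shows "x \<in> M" "y \<in> M" "z \<in> M" "d x z + d z y = d x y"
proof -
  interpret Metric_space M d by fact
  obtain c where c: "curve_between M d x y c" "curve_length d c = ereal (d x y)" "G = c ` {0..1}"
    using assms by (auto simp: minimal_geodesic_def)
  have cM: "c v \<in> M" if "v \<in> {0..1}" for v
    using c(1) that continuous_map_funspace unfolding curve_between_def pathin_def by fastforce
  have e: "c 0 = x" "c 1 = y" using c(1) by (auto simp: curve_between_def)
  obtain u where u: "u \<in> {0..1}" "z = c u" using c assms by auto
  show M: "x \<in> M" "y \<in> M" "z \<in> M" using cM[of 0] cM[of 1] cM[of u] u e by auto
  have "d x z + d z y \<le> d x y"
    using curve_length_ge[of u c] u e c(2) by simp
  then show "d x z + d z y = d x y" using triangle[OF M(1,3,2)] by simp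
qed

lemma geod_minimal:
  assumes "Metric_space M d" and g: "geod M d g a" and a: "0 \<le> a"
  shows "minimal_geodesic M d (g 0) (g a) (g ` {0..a})"
proof -
  interpret Metric_space M d by fact
  define c where "c u = g (u * a)" for u
  have ua: "u * a \<in> {0..a}" if "u \<in> {0..1}" for u using that a by (auto simp: mult_left_le_one_le)
  have dc: "d (c u) (c v) = \<bar>u - v\<bar> * a" if "u \<in> {0..1}" "v \<in> {0..1}" for u v
    using g ua[OF that(1)] ua[OF that(2)] a 
    by (simp add: c_def geod_def abs_mult flip: left_diff_distrib)
  have cM: "c u \<in> M" if "u \<in> {0..1}" for u
    using ua[OF that] g unfolding c_def geod_def by blast
  have "pathin mtopology c"
    unfolding pathin_def continuous_map_to_metric
  proof (intro ballI allI impI)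
    fix u e :: real
    assume u: "u \<in> topspace (top_of_set {0..1})" and e: "0 < e"
    define U where "U = ball u (e / (a + 1)) \<inter> {0..1}"
    have "c v \<in> mball (c u) e" if "v \<in> U" for v
    proof -
      have v: "v \<in> {0..1}" "\<bar>u - v\<bar> < e / (a + 1)" using that by (auto simp: U_def dist_real_def)
      then have "\<bar>u - v\<bar> * (a + 1) < e" using a by (simp add: field_simps)
      then have "\<bar>u - v\<bar> * a < e" using mult_left_mono[of a "a + 1" "\<bar>u - v\<bar>"] by simp
      then show ?thesis using dc[of u v] cM[of u] cM[of v] u v by simp
    qed
    moreover have "openin (top_of_set {0..1}) U" "u \<in> U" 
      using u e a by (auto simp: U_def openin_open_Int Int_commute)
    ultimately show "\<exists>U. openin (top_of_set {0..1}) U \<and> u \<in> U \<and> (\<forall>v\<in>U. c v \<in> mball (c u) e)"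
      by blast
  qed
  then have "curve_between M d (g 0) (g a) c" by (simp add: curve_between_def c_def)
  moreover have "curve_length d c = ereal (d (g 0) (g a))"
  proof (rule antisym)
    show "curve_length d c \<le> ereal (d (g 0) (g a))"
      unfolding curve_length_def
    proof (rule SUP_least, clarify)
      fix n :: nat and t :: "nat \<Rightarrow> real"
      assume t: "mono_on {..n} t" "t ` {..n} \<subseteq> {0..1}"
      have "(\<Sum>i<n. d (c (t i)) (c (t (Suc i)))) = (\<Sum>i<n. (t (Suc i) - t i) * a)"
      proof (rule sum.cong[OF refl])
        fix i assume "i \<in> {..<n}"
        then have "t i \<in> {0..1}" "t (Suc i) \<in> {0..1}" "t i \<le> t (Suc i)"
          using t by (auto intro: monotone_onD simp: image_subset_iff)
        then show "d (c (t i)) (c (t (Suc i))) = (t (Suc i) - t i) * a" by (simp add: dc)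
      qed
      also have "\<dots> = (t n - t 0) * a"
        by (simp add: sum_lessThan_telescope flip: sum_distrib_right)
      also have "\<dots> \<le> 1 * a"
      proof (rule mult_right_mono[OF _ a])
        have "t n \<in> {0..1}" "t 0 \<in> {0..1}" using t by auto
        then show "t n - t 0 \<le> 1" by simp
      qed
      finally show "ereal (\<Sum>i<n. d (c (t i)) (c (t (Suc i)))) \<le> ereal (d (g 0) (g a))"
        using geod_dist[OF g, of 0 a] a by simp
    qed
    show "ereal (d (g 0) (g a)) \<le> curve_length d c"
      using curve_length_ge[of 1 c] cM[of 1] by (simp add: c_def)
  qed
  moreover have "g ` {0..a} = c ` {0..1}"
  proof
    show "g ` {0..a} \<subseteq> c ` {0..1}"
    proof clarify
      fix s assume "s \<in> {0..a}"
      then show "g s \<in> c ` {0..1}"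
        using a by (cases "a = 0") (auto simp: c_def intro!: image_eqI[of _ _ "s / a"])
    qed
  qed (use ua in \<open>auto simp: c_def\<close>)
  ultimately show ?thesis unfolding minimal_geodesic_def by blast
qed

section \<open>The model plane in coordinates\<close>

text \<open>
  One bilinear form for the three ambient geometries: the Euclidean product for \<open>k > 0\<close>, the
  Minkowski product for \<open>k < 0\<close>, and the product of the horizontal parts for \<open>k = 0\<close>. With it the
  distance of the model plane has one description for all \<open>k\<close> (\<open>md_model_dist\<close>).
\<close>
definition bil :: "real \<Rightarrow> real^3 \<Rightarrow> real^3 \<Rightarrow> real" where
  "bil k x y = x $ 1 * y $ 1 + x $ 2 * y $ 2 + sgn k * (x $ 3 * y $ 3)"

lemma bil_diff: "bil k (x - y) (x - y) = bil k x x + bil k y y - 2 * bil k x y"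
  by (simp add: bil_def algebra_simps)

lemma bil_self: "k \<noteq> 0 \<Longrightarrow> x \<in> model_plane k \<Longrightarrow> k * bil k x x = 1"
  by (auto simp: model_plane_def bil_def inner_vec_def sum_3 minkowski_def split: if_splits)

lemma model_dist_nonneg: "0 \<le> model_dist k x y"
  using Metric_space.nonneg[OF Metric_space_model_plane] .

lemma model_dist_le: "k > 0 \<Longrightarrow> model_dist k x y \<le> pi / sqrt k"
  using sphere_le_1[of k x y] by (auto simp: model_dist_def abs_le_iff intro!: divide_right_mono arccos_ubound)

lemma k_bil:
  assumes "k \<noteq> 0" "x \<in> model_plane k" "y \<in> model_plane k"
  shows "k * bil k x y = cs k (model_dist k x y)"
proof (cases "k > 0")
  case True
  then have "cos (arccos (k * (x \<bullet> y))) = k * (x \<bullet> y)"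
    using sphere_le_1[OF True assms(2,3)] by (simp add: cos_arccos_abs)
  then show ?thesis
    using assms True by (simp add: model_dist_def cs_def bil_def inner_vec_def sum_3)
next
  case False
  then have k: "k < 0" using assms by simp
  then have "cosh (arcosh (k * minkowski x y)) = k * minkowski x y"
    using minkowski_ge_1[OF k assms(2,3)] by (simp add: cosh_arcosh_real)
  then show ?thesis
    using assms k by (simp add: model_dist_def cs_def bil_def minkowski_def)
qed

lemma md_model_dist:
  assumes "x \<in> model_plane k" "y \<in> model_plane k"
  shows "md k (model_dist k x y) = bil k (x - y) (x - y) / 2"
proof (cases "k = 0")
  case True
  then have "(dist x y)\<^sup>2 = bil k (x - y) (x - y)"
    using assms by (simp add: bil_def dist_norm power2_norm_eq_inner inner_vec_def sum_3 model_plane_def)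
  then show ?thesis using True assms by (simp add: md_def model_dist_def)
next
  case False
  have "k * bil k (x - y) (x - y) = 2 - 2 * (k * bil k x y)"
    using bil_self[OF False assms(1)] bil_self[OF False assms(2)] by (simp add: bil_diff algebra_simps)
  then show ?thesis using False k_bil[OF False assms] by (simp add: md_def field_simps)
qed

lemma model_dist_eqI:
  assumes "x \<in> model_plane k" "y \<in> model_plane k" "bil k (x - y) (x - y) / 2 = md k D" "0 \<le> D" 
    "k > 0 \<Longrightarrow> D \<le> pi / sqrt k"
  shows "model_dist k x y = D"
  using assms md_model_dist[OF assms(1,2)] model_dist_nonneg model_dist_le by (rule_tac md_inj[of k]) simp_all

text \<open>
  Geodesic polar coordinates. For \<open>k = 0\<close> the third coordinate is 0, since division by zero yields
  zero.
\<close>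
definition polar :: "real \<Rightarrow> real \<Rightarrow> real \<Rightarrow> real^3" where
  "polar k t \<alpha> = vector [sn k t * cos \<alpha>, sn k t * sin \<alpha>, cs k t / sqrt \<bar>k\<bar>]"

lemma bil_polar:
  assumes "k \<noteq> 0"
  shows "k * bil k (polar k s \<alpha>) (polar k t \<beta>) = cs k s * cs k t + k * (sn k s * sn k t * cos (\<alpha> - \<beta>))"
  using assms by (auto simp: bil_def polar_def cos_diff sgn_if field_simps simp flip: real_sqrt_mult)

lemma mem_model_plane_iff:
  "k \<noteq> 0 \<Longrightarrow> x \<in> model_plane k \<longleftrightarrow> k * bil k x x = 1 \<and> (k < 0 \<longrightarrow> 0 < x $ 3)"
  by (auto simp: model_plane_def bil_def inner_vec_def sum_3 minkowski_def field_simps sgn_if)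

lemma polar_in_model_plane: "polar k t \<alpha> \<in> model_plane k"
proof (cases "k = 0")
  case False
  have "k * bil k (polar k t \<alpha>) (polar k t \<alpha>) = 1"
    using bil_polar[OF False] cs_sn_square[of k t] by (simp add: power2_eq_square)
  moreover have "0 < polar k t \<alpha> $ 3" if "k < 0" using that by (simp add: polar_def cs_def)
  ultimately show ?thesis using False by (simp add: mem_model_plane_iff)
qed (simp add: model_plane_def polar_def)

lemma bil_polar_diff:
  "bil k (polar k s \<alpha> - polar k t \<beta>) (polar k s \<alpha> - polar k t \<beta>) / 2 = third_side k s t (cos (\<alpha> - \<beta>))"
proof (cases "k = 0")
  case True
  have "(s * cos \<alpha> - t * cos \<beta>)\<^sup>2 + (s * sin \<alpha> - t * sin \<beta>)\<^sup>2 = s\<^sup>2 + t\<^sup>2 - 2 * s * t * cos (\<alpha> - \<beta>)"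
    using sin_cos_squared_add[of \<alpha>] sin_cos_squared_add[of \<beta>] unfolding cos_diff by algebra
  then show ?thesis using True
    by (simp add: bil_def polar_def third_side_def md_def cs_def sn_def power2_eq_square field_simps)
next
  case False
  let ?x = "polar k s \<alpha>" and ?y = "polar k t \<beta>"
  have "k * bil k (?x - ?y) (?x - ?y) = 2 - 2 * (k * bil k ?x ?y)"
    using bil_self[OF False polar_in_model_plane] by (simp add: bil_diff algebra_simps)
  then show ?thesis using False
    by (simp add: bil_polar third_side_def md_def field_simps)
qed

lemma geod_polar:
  assumes "below_diam k L"
  shows "geod (model_plane k) (model_dist k) (\<lambda>t. polar k t 0) L"
  unfolding geod_def
proof (intro conjI ballI polar_in_model_plane model_dist_eqI)
  fix s t assume "s \<in> {0..L}" "t \<in> {0..L}"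
  show "bil k (polar k s 0 - polar k t 0) (polar k s 0 - polar k t 0) / 2 = md k \<bar>s - t\<bar>"
    by (simp add: bil_polar_diff third_side_eq_diff md_abs)
  assume "k > 0"
  with \<open>s \<in> {0..L}\<close> \<open>t \<in> {0..L}\<close> assms show "\<bar>s - t\<bar> \<le> pi / sqrt k"
    by (auto simp: below_diam_def)
qed auto

text \<open>
  Comparison with explicit numbers in place of comparison triangles. The comparison triangle is
  placed with \<open>q\<close> at the origin of polar coordinates and \<open>r\<close> in direction 0, so that \<open>p\<close> lies in the
  direction of the comparison angle.
\<close>
lemma toponogov_comparison_third_side:
  assumes top: "toponogov_comparison k d p q r G" and "s \<in> G"
    and t: "0 \<le> d q s" "d q s \<le> d q r" and "0 < d q r" "0 < d p q" "below_diam k (d q r + d p q)"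
    and tri: "\<bar>d q r - d p q\<bar> \<le> d p r" "d p r \<le> d q r + d p q" "d p s \<le> d q s + d p q"
  shows "third_side k (d q s) (d p q) (cos_cmp k (d q r) (d p q) (d p r)) \<le> md k (d p s)"
proof -
  define L A B t where "L = d q r" and "A = d p q" and "B = d p r" and "t = d q s"
  note defs = L_def[symmetric] A_def[symmetric] B_def[symmetric] t_def[symmetric]
  note a = assms(3-)[unfolded defs]
  define c where "c = cos_cmp k L A B"
  have c: "-1 \<le> c" "c \<le> 1" unfolding c_def using a by (auto intro!: cos_cmp_bounds)
  have ok: "below_diam k L" "below_diam k A" "below_diam k B" "below_diam k t"
    using a by (auto simp: below_diam_def)
  let ?\<alpha> = "arccos c"
  let ?P = "\<lambda>t. polar k t 0"
  let ?p = "polar k A ?\<alpha>"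
  have pL: "model_dist k ?p (?P u) = D" 
    if "third_side k u A c = md k D" "0 \<le> D" "k > 0 \<Longrightarrow> D \<le> pi / sqrt k" for u D
    using that c by (intro model_dist_eqI polar_in_model_plane)
      (auto simp: bil_polar_diff third_side_commute[of k A])
  have g: "geod (model_plane k) (model_dist k) ?P L" using ok geod_polar by blast
  have gd: "model_dist k (?P u) (?P v) = \<bar>u - v\<bar>" if "0 \<le> u" "u \<le> L" "0 \<le> v" "v \<le> L" for u v
    using geod_dist[OF g] that by blast
  have "minimal_geodesic (model_plane k) (model_dist k) (?P 0) (?P L) (?P ` {0..L})"
    using geod_minimal[OF Metric_space_model_plane g] a by simp
  moreover have "model_dist k ?p (?P 0) = A"
    using a ok by (intro pL) (auto simp: third_side_def below_diam_def)
  moreover have "model_dist k ?p (?P L) = B"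
    using a ok by (intro pL) (auto simp: c_def third_side_cos_cmp below_diam_def)
  moreover have "model_dist k (?P 0) (?P L) = L" "t = model_dist k (?P 0) (?P t)" "?P t \<in> ?P ` {0..L}"
    using gd a by auto
  ultimately have le: "model_dist k ?p (?P t) \<le> d p s"
    using top[unfolded toponogov_comparison_def, rule_format, of ?p "?P 0" "?P L" "?P ` {0..L}" s "?P t"] 
      \<open>s \<in> G\<close> polar_in_model_plane unfolding defs by simp
  have "third_side k t A c = md k (model_dist k ?p (?P t))"
    using c md_model_dist[OF polar_in_model_plane polar_in_model_plane] by (simp add: bil_polar_diff third_side_commute[of k t])
  moreover have "md k (model_dist k ?p (?P t)) \<le> md k (d p s)"
    using le a model_dist_nonneg by (intro md_mono) (auto simp: below_diam_def)
  ultimately show ?thesis unfolding defs c_def[symmetric] by simp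
qed

text \<open>
  Stewart's theorem for arbitrary points of the model plane. A point \<open>s\<close> between \<open>q\<close> and \<open>r\<close> satisfies
  the linear relation \<open>sn k (t + u) s = sn k u q + sn k t r\<close> in the ambient space, and
  pairing this relation with \<open>p\<close> gives the claim.
\<close>
lemma model_four_point:
  assumes pl: "p \<in> model_plane k" "q \<in> model_plane k" "r \<in> model_plane k" "s \<in> model_plane k"
    and t: "model_dist k q s = t" and u: "model_dist k s r = u" and L: "model_dist k q r = t + u"
    and pos: "0 < t + u" "below_diam k (t + u)"
  shows "sn k (t + u) * md k (model_dist k p s) =
     sn k u * (md k (model_dist k p q) - md k t) + sn k t * (md k (model_dist k p r) - md k u)"
proof -
  define a b c where "a = sn k (t + u)" and "b = sn k u" and "c = sn k t"
  define v where "v = (\<chi> i. a * s $ i - b * q $ i - c * r $ i)"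
  have v: "bil k v v = a\<^sup>2 * bil k s s + b\<^sup>2 * bil k q q + c\<^sup>2 * bil k r r 
      - 2 * a * b * bil k q s - 2 * a * c * bil k s r + 2 * b * c * bil k q r"
    "bil k v q = a * bil k q s - b * bil k q q - c * bil k q r"
    "bil k p v = a * bil k p s - b * bil k p q - c * bil k p r"
    "bil k s v = a * bil k s s - b * bil k q s - c * bil k s r"
    by (simp_all add: bil_def v_def algebra_simps power2_eq_square)
  have m: "bil k (q - s) (q - s) = 2 * md k t" "bil k (s - r) (s - r) = 2 * md k u"
    "bil k (q - r) (q - r) = 2 * md k (t + u)"
    using md_model_dist[OF pl(2,4)] md_model_dist[OF pl(4,3)] md_model_dist[OF pl(2,3)] t u L by simp_all
  show ?thesis
  proof (cases "k = 0")
    case True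
    then have abc: "a = t + u" "b = u" "c = t" by (auto simp: a_def b_def c_def sn_def)
    have mk: "md k x = x\<^sup>2 / 2" for x using True by (simp add: md_def)
    have "bil k v v = 0" using m unfolding abc mk v bil_diff
      by algebra
    then have "v $ 1 = 0" "v $ 2 = 0" using True by (auto simp: bil_def sum_squares_eq_zero_iff)
    then have "bil k p v = 0" "bil k s v = 0" using True by (auto simp: bil_def)
    then have "(t + u) * bil k (p - s) (p - s) = u * (bil k (p - q) (p - q) - t\<^sup>2) + t * (bil k (p - r) (p - r) - u\<^sup>2)"
      using m unfolding mk bil_diff v abc by algebra
    moreover have "sn k x = x" for x using True by (simp add: sn_def)
    ultimately show ?thesis 
      unfolding md_model_dist[OF pl(1,2)] md_model_dist[OF pl(1,3)] md_model_dist[OF pl(1,4)] mk[of t] mk[of u]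
      by (simp add: field_simps)
  next
    case False
    have self: "k * bil k x x = 1" if "x \<in> model_plane k" for x using bil_self False that by blast
    have abc: "a = b * cs k t + cs k u * c" unfolding a_def b_def c_def by (simp add: sn_add)
    have qs: "k * bil k q s = cs k t" and sr: "k * bil k s r = cs k u" and qr: "k * bil k q r = cs k (t + u)"
      using k_bil[OF False] pl t u L by auto
    have vv: "k * bil k v v = 0" 
      using self[OF pl(2)] self[OF pl(3)] self[OF pl(4)] qs sr qr cs_sn_square[of k t] cs_sn_square[of k u]
      unfolding cs_add b_def[symmetric] c_def[symmetric] v abc by algebra
    have vq: "k * bil k v q = 0"
      using self[OF pl(2)] qs qr cs_sn_square[of k t]
      unfolding cs_add b_def[symmetric] c_def[symmetric] v abc by algebra
    \<comment> \<open>For \<open>k < 0\<close> a null vector may be nonzero, but not if it is orthogonal to the timelike vector \<open>q\<close>.\<close>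
    have "v = 0"
    proof (cases "k > 0")
      case True
      then have "v \<bullet> v = 0" using vv by (simp add: bil_def inner_vec_def sum_3)
      then show ?thesis by simp
    next
      case neg: False
      then have k: "k < 0" using False by simp
      define e where "e = - 1 / k"
      have e: "e > 0" using k by (simp add: e_def divide_neg_neg)
      have vv': "(v$1)\<^sup>2 + (v$2)\<^sup>2 = (v$3)\<^sup>2" and vq': "v$1 * q$1 + v$2 * q$2 = v$3 * q$3"
        using vv vq k by (simp_all add: bil_def power2_eq_square)
      have q: "(q$3)\<^sup>2 = e + ((q$1)\<^sup>2 + (q$2)\<^sup>2)"
        using self[OF pl(2)] k by (simp add: bil_def e_def power2_eq_square field_simps)
      have "(v$3 * q$3)\<^sup>2 + (v$1 * q$2 - v$2 * q$1)\<^sup>2 = ((v$1)\<^sup>2 + (v$2)\<^sup>2) * ((q$1)\<^sup>2 + (q$2)\<^sup>2)"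
        unfolding vq'[symmetric] by algebra
      then have "e * (v$3)\<^sup>2 + (v$1 * q$2 - v$2 * q$1)\<^sup>2 = 0"
        unfolding vv' using q by algebra
      then have "v$3 = 0" using e by (metis add_nonneg_eq_0_iff less_eq_real_def mult_eq_0_iff mult_nonneg_nonneg order_less_irrefl power_eq_0_iff zero_le_power2)
      then show ?thesis using vv' by (simp add: sum_power2_eq_zero_iff vec_eq_iff forall_3)
    qed
    then have pv: "bil k p v = 0" by (simp add: bil_def)
    define Ms Mq Mr where "Ms = md k (model_dist k p s)" and "Mq = md k (model_dist k p q)"
      and "Mr = md k (model_dist k p r)"
    have p: "k * bil k p s = 1 - k * Ms" "k * bil k p q = 1 - k * Mq" "k * bil k p r = 1 - k * Mr"
      using k_bil[OF False] pl unfolding Ms_def Mq_def Mr_def by (simp_all add: cs_eq)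
    have "k * (a * Ms) = k * (b * (Mq - md k t) + c * (Mr - md k u))"
      using pv p cs_eq[of k t] cs_eq[of k u] unfolding v abc by algebra
    then show ?thesis using False unfolding Ms_def Mq_def Mr_def a_def b_def c_def by simp
  qed
qed

section \<open>Complete locally compact length spaces\<close>

locale complete_length_space = Metric_space M d for M :: "'a set" and d +
  assumes length_space: "length_space M d"
    and mcomplete: mcomplete
    and locally_compact: "locally_compact_space mtopology"
begin

lemma continuous_map_dist:
  assumes "continuous_map X mtopology f" "continuous_map X mtopology g"
  shows "continuous_map X euclideanreal (\<lambda>u. d (f u) (g u))"
  using continuous_map_mdist[of X "metric (M, d)" f g] assms by simp

lemma almost_between:
  assumes "x \<in> M" "y \<in> M" "0 \<le> r" "r \<le> d x y" "0 < e"
  obtains z where "z \<in> M" "d x z = r" "d z y \<le> d x y - r + e"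
proof -
  have "(INF c \<in> {c. curve_between M d x y c}. curve_length d c) < ereal (d x y + e)"
    using length_space assms unfolding length_space_def by (metis ereal_less_eq(3) less_add_same_cancel1 less_ereal.simps(1))
  then obtain c where c: "curve_between M d x y c" "curve_length d c < ereal (d x y + e)"
    by (auto simp: INF_less_iff)
  have p: "pathin mtopology c" and e: "c 0 = x" "c 1 = y" using c by (auto simp: curve_between_def)
  have cM: "c v \<in> M" if "v \<in> {0..1}" for v
    using p that continuous_map_funspace unfolding pathin_def by fastforce
  have "continuous_on {0..1} (\<lambda>u. d x (c u))"
    using continuous_map_dist[of "top_of_set {0..1}" "\<lambda>_. x" c] p assms by (simp add: pathin_def)
  then obtain u where u: "0 \<le> u" "u \<le> 1" "d x (c u) = r"
    using IVT'[of "\<lambda>u. d x (c u)" 0 r 1] e assms by auto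
  have "ereal (d x (c u) + d (c u) y) < ereal (d x y + e)"
    using curve_length_ge[OF u(1,2), of c] c(2) e by (metis le_less_trans)
  then show ?thesis using that[of "c u"] u cM[of u] by simp
qed

text \<open>
  A ball of a length space is close to the slightly larger concentric balls; this is what lets
  compactness spread from one ball to the next in the Hopf-Rinow theorem.
\<close>
lemma mcball_near:
  assumes "x \<in> M" "y \<in> M" "0 \<le> r" "d x y \<le> r + \<delta>" "0 \<le> \<delta>" "\<delta> < e"
  obtains z where "z \<in> mcball x r" "d z y < e"
proof (cases "d x y \<le> r")
  case True
  then show ?thesis using that[of y] assms by simp
next
  case False
  obtain z where "z \<in> M" "d x z = r" "d z y \<le> d x y - r + (e - \<delta>) / 2"
    using almost_between[of x y r "(e - \<delta>) / 2"] assms False by auto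
  then show ?thesis using that[of z] assms by (simp add: field_simps)
qed

lemma compact_neighbourhood:
  assumes K: "compactin mtopology K"
  obtains \<epsilon> C where "0 < \<epsilon>" "compactin mtopology C" "\<And>x. x \<in> K \<Longrightarrow> mball x \<epsilon> \<subseteq> C"
proof -
  have "\<forall>x\<in>K. \<exists>U C. openin mtopology U \<and> compactin mtopology C \<and> x \<in> U \<and> U \<subseteq> C"
    using locally_compact compactin_subset_topspace[OF K] unfolding locally_compact_space_def by blast
  from bchoice[OF this] obtain U where 
    "\<forall>x\<in>K. \<exists>C. openin mtopology (U x) \<and> compactin mtopology C \<and> x \<in> U x \<and> U x \<subseteq> C" ..
  from bchoice[OF this] obtain C where UC:
    "\<forall>x\<in>K. openin mtopology (U x) \<and> compactin mtopology (C x) \<and> x \<in> U x \<and> U x \<subseteq> C x" ..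
  have "\<exists>\<F>. finite \<F> \<and> \<F> \<subseteq> U ` K \<and> K \<subseteq> \<Union>\<F>"
    using UC by (intro compactinD[OF K]) auto
  then obtain \<F> where F: "finite \<F>" "\<F> \<subseteq> U ` K" "K \<subseteq> \<Union>\<F>" by blast
  then obtain J where J: "J \<subseteq> K" "finite J" "\<F> = U ` J" using finite_subset_image[OF F(1,2)] by blast
  have "openin mtopology (\<Union>\<F>)" using J UC by (intro openin_Union) auto
  then obtain \<epsilon> where e: "\<epsilon> > 0" "\<And>x. x \<in> K \<Longrightarrow> mball x \<epsilon> \<subseteq> \<Union>\<F>"
    using lebesgue_number[OF K, of "{\<Union>\<F>}"] F(3) by auto
  have C: "compactin mtopology (\<Union>(C ` J))" using J UC by (intro compactin_Union) auto
  have "\<Union>\<F> \<subseteq> \<Union>(C ` J)" using J UC by fastforce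
  then show ?thesis using that[OF e(1) C] e(2) by (meson subset_trans)
qed

lemma mcball_compact_subset: "compactin mtopology C \<Longrightarrow> mcball x r \<subseteq> C \<Longrightarrow> compactin mtopology (mcball x r)"
  by (rule closed_compactin) auto

text \<open>
  The Hopf-Rinow theorem. The radii with compact balls form an interval from 0. The interval contains
  its supremum \<open>R\<close>, because finite nets of smaller balls are nets of the ball of radius \<open>R\<close> and \<open>M\<close> is
  complete. A compact ball has a compact neighbourhood, so no finite supremum can exist.
\<close>
theorem compact_mcball:
  assumes x: "x \<in> M"
  shows "compactin mtopology (mcball x r)"
proof (rule ccontr)
  assume not: "\<not> compactin mtopology (mcball x r)"
  define S where "S = {s. 0 \<le> s \<and> compactin mtopology (mcball x s)}"
  have "y = x" if "y \<in> mcball x 0" for y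
    using that nonneg[of x y] zero[of x y] by simp
  then have "mcball x 0 = {x}" using x by auto
  then have S0: "0 \<in> S" using x by (simp add: S_def)
  have "s \<le> r" if "s \<in> S" for s
  proof (rule ccontr)
    assume "\<not> s \<le> r"
    then have "compactin mtopology (mcball x r)"
      using that mcball_compact_subset[of "mcball x s" x r] mcball_subset_concentric[of r s x] by (simp add: S_def)
    then show False using not by blast
  qed
  then have bdd: "bdd_above S" by (auto intro!: bdd_aboveI)
  define R where "R = Sup S"
  have le: "s \<le> R" if "s \<in> S" for s using cSup_upper[OF that bdd] by (simp add: R_def)
  have R0: "0 \<le> R" using le S0 by blast
  have "mtotally_bounded (mcball x R)"
    unfolding mtotally_bounded_def
  proof (intro allI impI)
    fix e :: real assume e: "0 < e"
    obtain s where s: "s \<in> S" "R - e / 3 < s"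
      using less_cSup_iff[of S "R - e / 3"] S0 bdd e unfolding R_def by fastforce
    then have "mtotally_bounded (mcball x s)" by (simp add: S_def compactin_imp_mtotally_bounded)
    then obtain K where K: "finite K" "K \<subseteq> mcball x s" "mcball x s \<subseteq> (\<Union>z\<in>K. mball z (e / 2))"
      using e unfolding mtotally_bounded_def by (meson half_gt_zero)
    have "y \<in> (\<Union>z\<in>K. mball z e)" if y: "y \<in> mcball x R" for y
    proof -
      obtain z where z: "z \<in> mcball x s" "d z y < e / 2"
        using mcball_near[of x y s "R - s" "e / 2"] y s le[OF s(1)] e by (auto simp: S_def)
      then obtain w where w: "w \<in> K" "d w z < e / 2" "w \<in> M" using K(3) by auto
      have "z \<in> M" "y \<in> M" using z(1) y by auto
      then have "d w y < e" using triangle[of w z y] w z(2) by linarith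
      then show ?thesis using w \<open>y \<in> M\<close> by auto
    qed
    moreover have "K \<subseteq> mcball x R" using K le[OF s(1)] mcball_subset_concentric by blast
    ultimately show "\<exists>K. finite K \<and> K \<subseteq> mcball x R \<and> mcball x R \<subseteq> (\<Union>x\<in>K. mball x e)"
      using K(1) by blast
  qed
  then have "compactin mtopology (mcball x R)"
    using mtotally_bounded_eq_compact_closure_of[OF mcomplete] by (simp add: closure_of_closedin)
  then obtain e C where C: "0 < e" "compactin mtopology C" "\<And>z. z \<in> mcball x R \<Longrightarrow> mball z e \<subseteq> C"
    using compact_neighbourhood by metis
  have "mcball x (R + e / 2) \<subseteq> C"
  proof
    fix y assume y: "y \<in> mcball x (R + e / 2)"
    then obtain z where "z \<in> mcball x R" "d z y < e"
      using mcball_near[of x y R "e / 2" e] x R0 C(1) by auto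
    then show "y \<in> C" using C(3)[of z] y by auto
  qed
  then have "R + e / 2 \<in> S" using mcball_compact_subset[OF C(2)] R0 C(1) by (simp add: S_def)
  then show False using le C(1) by fastforce
qed

text \<open>By compactness of balls, almost intermediate points can be replaced by intermediate points.\<close>
lemma between:
  assumes xy: "x \<in> M" "y \<in> M" and r: "0 \<le> r" "r \<le> d x y"
  obtains z where "z \<in> M" "d x z = r" "d z y = d x y - r"
proof -
  define K where "K = {z \<in> topspace mtopology. d x z \<in> {r}}"
  have "closedin mtopology K"
    unfolding K_def using xy
    by (intro closedin_continuous_map_preimage[of _ euclideanreal] continuous_map_dist) auto
  moreover have "K \<subseteq> mcball x r" using xy by (auto simp: K_def)
  ultimately have "compactin mtopology K" using compact_mcball[OF xy(1)] closed_compactin by blast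
  then have "compact ((\<lambda>z. d z y) ` K)"
    using image_compactin[of mtopology K euclideanreal "\<lambda>z. d z y"] continuous_map_dist[of mtopology "\<lambda>z. z" "\<lambda>_. y"] xy
    by auto
  moreover have "K \<noteq> {}" using almost_between[OF xy r, of 1] by (auto simp: K_def)
  ultimately obtain z where z: "z \<in> K" "\<And>w. w \<in> K \<Longrightarrow> d z y \<le> d w y"
    using compact_attains_inf[of "(\<lambda>z. d z y) ` K"] by auto
  have "d z y \<le> d x y - r"
  proof (rule field_le_epsilon)
    fix e :: real assume "0 < e"
    then obtain w where "w \<in> M" "d x w = r" "d w y \<le> d x y - r + e" using almost_between[OF xy r] by blast
    then show "d z y \<le> d x y - r + e" using z(2)[of w] by (simp add: K_def)
  qed
  then show ?thesis using that[of z] z(1) triangle[of x z y] xy by (simp add: K_def)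
qed

text \<open>
  A new parameter is inserted between its two neighbours in the finite set, with an intermediate point
  of their images.
\<close>
lemma finite_geodesic_points:
  assumes xy: "x \<in> M" "y \<in> M" and F: "finite F" "F \<subseteq> {0..d x y}"
  shows "\<exists>c. c 0 = x \<and> c (d x y) = y \<and> (\<forall>s\<in>insert 0 (insert (d x y) F). c s \<in> M \<and>
      (\<forall>t\<in>insert 0 (insert (d x y) F). d (c s) (c t) = \<bar>s - t\<bar>))"
  using F
proof (induction F rule: finite_induct)
  case empty
  show ?case
    using xy by (intro exI[of _ "\<lambda>s. if s = 0 then x else y"]) (auto simp: commute)
next
  case (insert v F)
  define L where "L = d x y"
  define T where "T = insert 0 (insert L F)"
  have "\<exists>c. c 0 = x \<and> c L = y \<and> (\<forall>s\<in>T. c s \<in> M \<and> (\<forall>t\<in>T. d (c s) (c t) = \<bar>s - t\<bar>))"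
    unfolding T_def L_def by (rule insert.IH) (use insert.prems in auto)
  then obtain c where c0: "c 0 = x" "c L = y" 
    and c': "\<forall>s\<in>T. c s \<in> M \<and> (\<forall>t\<in>T. d (c s) (c t) = \<bar>s - t\<bar>)" by (elim exE conjE)
  have c: "\<And>s. s \<in> T \<Longrightarrow> c s \<in> M" "\<And>s t. s \<in> T \<Longrightarrow> t \<in> T \<Longrightarrow> d (c s) (c t) = \<bar>s - t\<bar>"
    using c' by auto
  show ?case
  proof (cases "v \<in> T")
    case True
    then have "insert 0 (insert (d x y) (insert v F)) = T" by (auto simp: T_def L_def)
    then show ?thesis using c0 c by (auto simp: L_def)
  next
    case False
    have v: "0 < v" "v < L" using False insert.prems by (auto simp: T_def L_def less_le)
    have fin: "finite {s \<in> T. s < v}" "finite {s \<in> T. v < s}" using insert by (auto simp: T_def)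
    have ne: "0 \<in> {s \<in> T. s < v}" "L \<in> {s \<in> T. v < s}" using v by (auto simp: T_def)
    define a b where "a = Max {s \<in> T. s < v}" and "b = Min {s \<in> T. v < s}"
    have a: "a \<in> T" "a < v" and b: "b \<in> T" "v < b"
      using Max_in[OF fin(1)] Min_in[OF fin(2)] ne unfolding a_def b_def by blast+
    have split: "s \<le> a \<or> b \<le> s" if "s \<in> T" for s
      using Max_ge[OF fin(1), of s] Min_le[OF fin(2), of s] that False unfolding a_def b_def
      by (cases s v rule: linorder_cases) auto
    obtain z where z: "z \<in> M" "d (c a) z = v - a" "d z (c b) = b - v"
      using between[OF c(1)[OF a(1)] c(1)[OF b(1)], of "v - a"] c(2)[OF a(1) b(1)] a b by auto
    have zd: "d z (c s) = \<bar>v - s\<bar>" if s: "s \<in> T" for s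
    proof -
      have M: "c a \<in> M" "c b \<in> M" "c s \<in> M" using c a b s by auto
      note sym = commute[of z "c s"] commute[of z "c a"] commute[of z "c b"] commute[of "c a" "c s"]
      have d: "d (c s) (c a) = \<bar>s - a\<bar>" "d (c s) (c b) = \<bar>s - b\<bar>" 
        using c(2) s a b by auto
      consider "s \<le> a" | "b \<le> s" using split[OF s] by blast
      then show ?thesis
      proof cases
        case 1
        have "d z (c s) \<le> d z (c a) + d (c a) (c s)" "d (c s) (c b) \<le> d (c s) z + d z (c b)"
          using triangle M z(1) by blast+
        then show ?thesis using 1 d sym z a b by linarith
      next
        case 2
        have "d z (c s) \<le> d z (c b) + d (c b) (c s)" "d (c s) (c a) \<le> d (c s) z + d z (c a)"
          using triangle M z(1) by blast+
        then show ?thesis using 2 d sym commute[of "c b" "c s"] z a b by linarith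
      qed
    qed
    have "v \<noteq> 0" "v \<noteq> L" using v by auto
    have eq: "insert 0 (insert (d x y) (insert v F)) = insert v T" by (auto simp: T_def L_def)
    show ?thesis
      unfolding eq
    proof (intro exI[of _ "c(v := z)"] conjI ballI)
      show "(c(v := z)) 0 = x" "(c(v := z)) (d x y) = y"
        using c0 \<open>v \<noteq> 0\<close> \<open>v \<noteq> L\<close> by (simp_all add: L_def)
      fix s assume s: "s \<in> insert v T"
      show "(c(v := z)) s \<in> M" using s c(1) z(1) by auto
      fix t assume t: "t \<in> insert v T"
      show "d ((c(v := z)) s) ((c(v := z)) t) = \<bar>s - t\<bar>"
        using s t zd[of s] zd[of t] c(2)[of s t] z(1) commute[of "c s" z] by auto
    qed
  qed
qed

text \<open>
  A geodesic is a point of the compact product of balls \<open>mcball x L\<close> over all parameters in \<open>{0..L}\<close>,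
  subject to one closed condition for each pair of parameters. Finitely many of these conditions
  can be satisfied at once, so by Tychonoff's theorem all of them can.
\<close>
theorem geodesic_exists:
  assumes xy: "x \<in> M" "y \<in> M"
  obtains g where "geod M d g (d x y)" "g 0 = x" "g (d x y) = y"
proof -
  define L where "L = d x y"
  define I where "I = {0..L}"
  define B where "B = mcball x L"
  define T where "T = product_topology (\<lambda>_. subtopology mtopology B) I"
  have topT: "topspace T = I \<rightarrow>\<^sub>E B"
    by (simp add: T_def topspace_product_topology B_def Int_absorb1 mcball_subset_mspace)
  have "compact_space T"
    using compact_mcball[OF xy(1)] by (simp add: T_def B_def compact_space_product_topology compact_space_subtopology)
  have proj: "continuous_map T mtopology (\<lambda>c. c s)" if "s \<in> I" for s
    using continuous_map_product_projection[of s I "\<lambda>_. subtopology mtopology B"] that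
    unfolding T_def by (simp add: continuous_map_in_subtopology)
  define Z where "Z = (\<lambda>(s :: real, t). {c \<in> topspace T. d (c s) (c t) \<in> {\<bar>s - t\<bar>}}
    \<inter> {c \<in> topspace T. d x (c s) \<in> {s}} \<inter> {c \<in> topspace T. d (c s) y \<in> {L - s}})"
  have closed: "closedin T (Z p)" if "p \<in> I \<times> I" for p
  proof -
    have level: "closedin T {c \<in> topspace T. f c \<in> {r}}" if "continuous_map T euclideanreal f" for f r
      using that by (rule closedin_continuous_map_preimage) simp
    show ?thesis
    proof (cases p)
      case (Pair a b)
      then have ab: "a \<in> I" "b \<in> I" using that by auto
      have "continuous_map T mtopology (\<lambda>_. x)" "continuous_map T mtopology (\<lambda>_. y)" using xy by simp_all
      then show ?thesis
        unfolding Z_def Pair prod.case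
        by (intro closedin_Int level continuous_map_dist proj ab)
    qed
  qed
  have fip: "\<Inter>\<F> \<noteq> {}" if fin: "finite \<F>" and sub: "\<F> \<subseteq> Z ` (I \<times> I)" for \<F>
  proof -
    obtain P where P: "P \<subseteq> I \<times> I" "finite P" "\<F> = Z ` P" using finite_subset_image[OF fin sub] by blast
    define F where "F = fst ` P \<union> snd ` P"
    have F: "finite F" "F \<subseteq> I" using P by (auto simp: F_def)
    define F' where "F' = insert 0 (insert L F)"
    have "\<exists>c. c 0 = x \<and> c L = y \<and> (\<forall>s\<in>F'. c s \<in> M \<and> (\<forall>t\<in>F'. d (c s) (c t) = \<bar>s - t\<bar>))"
      unfolding F'_def L_def by (rule finite_geodesic_points[OF xy F[unfolded I_def L_def]])
    then obtain c where c: "c 0 = x" "c L = y" "\<forall>s\<in>F'. c s \<in> M \<and> (\<forall>t\<in>F'. d (c s) (c t) = \<bar>s - t\<bar>)"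
      by (elim exE conjE)
    have F'I: "F' \<subseteq> I" using F by (auto simp: F'_def I_def L_def)
    define c' where "c' = restrict (\<lambda>t. if t \<in> F' then c t else x) I"
    have c': "c' s = c s" "d x (c s) = s" "d (c s) y = L - s" "c s \<in> M" if "s \<in> F'" for s
    proof -
      have "d (c 0) (c s) = \<bar>0 - s\<bar>" "d (c s) (c L) = \<bar>s - L\<bar>"
        using c(3) that by (auto simp: F'_def)
      moreover have "s \<in> I" using that F'I by blast
      ultimately show "c' s = c s" "d x (c s) = s" "d (c s) y = L - s" "c s \<in> M" 
        using c that by (auto simp: c'_def I_def)
    qed
    have "c' \<in> topspace T"
      using c' F'I xy unfolding topT c'_def by (auto simp: B_def I_def L_def)
    moreover have "s \<in> F' \<and> t \<in> F'" if "(s, t) \<in> P" for s t using that by (force simp: F'_def F_def)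
    ultimately have "c' \<in> Z p" if "p \<in> P" for p
      using that c' c(3) by (cases p) (auto simp: Z_def)
    then show ?thesis using P(3) by blast
  qed
  have "(\<forall>C\<in>Z ` (I \<times> I). closedin T C) \<and> (\<forall>\<F>. finite \<F> \<and> \<F> \<subseteq> Z ` (I \<times> I) \<longrightarrow> \<Inter>\<F> \<noteq> {})"
    using closed fip by simp
  then have "\<Inter>(Z ` (I \<times> I)) \<noteq> {}"
    using \<open>compact_space T\<close> unfolding compact_space_fip by simp
  then obtain g where "g \<in> \<Inter>(Z ` (I \<times> I))" by blast
  then have g: "\<And>s t. s \<in> I \<Longrightarrow> t \<in> I \<Longrightarrow> g \<in> Z (s, t)" by blast
  have I: "0 \<in> I" "L \<in> I" by (auto simp: I_def L_def)
  have gM: "g s \<in> M" if "s \<in> I" for s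
    using g[OF that that] that mcball_subset_mspace[of x L] unfolding Z_def topT B_def by auto
  have "geod M d g L" using g gM unfolding geod_def Z_def I_def[symmetric] by auto
  moreover have "g 0 = x" "g L = y"
    using g[OF I(1,1)] g[OF I(2,2)] gM[OF I(1)] gM[OF I(2)] xy by (auto simp: Z_def zero commute)
  ultimately show ?thesis using that unfolding L_def by blast
qed

end

section \<open>Angles\<close>

lemma monotone_tendsto_at_right:
  fixes f :: "real \<Rightarrow> real"
  assumes "0 < \<delta>" and mono: "\<And>s t. 0 < s \<Longrightarrow> s \<le> t \<Longrightarrow> t < \<delta> \<Longrightarrow> f s \<le> f t"
    and lb: "\<And>t. 0 < t \<Longrightarrow> t < \<delta> \<Longrightarrow> m \<le> f t"
  shows "(f \<longlongrightarrow> Inf (f ` {0<..<\<delta>})) (at_right 0)"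
proof -
  have bdd: "bdd_below (f ` {0<..<\<delta>})" using lb by (intro bdd_belowI[of _ m]) auto
  have ne: "f ` {0<..<\<delta>} \<noteq> {}" using assms(1) by simp
  show ?thesis
  proof (rule order_tendstoI)
    fix a assume "a < Inf (f ` {0<..<\<delta>})"
    then have "a < f t" if "0 < t" "t < \<delta>" for t
      using cInf_lower[OF _ bdd, of "f t"] that by force
    then show "\<forall>\<^sub>F t in at_right 0. a < f t"
      using assms(1) by (auto simp: eventually_at_right_field)
  next
    fix a assume "Inf (f ` {0<..<\<delta>}) < a"
    then obtain y where "y \<in> f ` {0<..<\<delta>}" "y < a" using cInf_lessD[OF ne] by blast
    then obtain u where u: "0 < u" "u < \<delta>" "f u < a" by auto
    then have "f t < a" if "0 < t" "t < u" for t using mono[of t u] that by simp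
    then show "\<forall>\<^sub>F t in at_right 0. f t < a"
      using u by (auto simp: eventually_at_right_field)
  qed
qed

locale alexandrov = complete_length_space +
  fixes k :: real
  assumes alexandrov: "alexandrov_space k M d"
begin

definition comparison_on :: "'a set \<Rightarrow> bool" where
  "comparison_on U \<longleftrightarrow> (\<forall>p q r G. p \<in> U \<and> minimal_geodesic M d q r G \<and> G \<subseteq> U \<and>
     (k > 0 \<longrightarrow> d p q + d p r + d q r < 2 * pi / sqrt k) \<longrightarrow> toponogov_comparison k d p q r G)"

definition comparison_radius :: "'a \<Rightarrow> real \<Rightarrow> bool" where
  "comparison_radius x \<epsilon> \<longleftrightarrow> 0 < \<epsilon> \<and> below_diam k \<epsilon> \<and> comparison_on (mball x \<epsilon>)"

lemma comparison_on_subset: "comparison_on U \<Longrightarrow> V \<subseteq> U \<Longrightarrow> comparison_on V"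
  unfolding comparison_on_def by blast

text \<open>A Lebesgue number for the cover by the neighbourhoods with comparison.\<close>
lemma uniform_comparison_radius:
  assumes "compactin mtopology K"
  shows "\<exists>\<epsilon>>0. \<forall>x\<in>K. comparison_radius x \<epsilon>"
proof -
  define \<C> where "\<C> = {V. openin mtopology V \<and> comparison_on V}"
  have "\<exists>V. openin mtopology V \<and> x \<in> V \<and> comparison_on V" if "x \<in> M" for x
  proof -
    have "\<exists>V U. openin mtopology V \<and> x \<in> V \<and> V \<subseteq> U \<and> U \<subseteq> M \<and> comparison_on U"
      using alexandrov that unfolding alexandrov_space_def comparison_on_def[symmetric] by blast
    then obtain V U where V: "openin mtopology V" "x \<in> V" "V \<subseteq> U" "comparison_on U" by (elim exE conjE)
    show ?thesis using V(1,2) comparison_on_subset[OF V(4,3)] by (intro exI conjI)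
  qed
  then have "K \<subseteq> \<Union>\<C>" using compactin_subset_topspace[OF assms] by (auto simp: \<C>_def)
  moreover have "openin mtopology U" if "U \<in> \<C>" for U using that by (simp add: \<C>_def)
  ultimately have "\<exists>e>0. \<forall>x\<in>K. \<exists>U\<in>\<C>. mball x e \<subseteq> U"
    by (rule lebesgue_number[OF assms])
  then obtain e where e: "e > 0" "\<forall>x\<in>K. \<exists>U\<in>\<C>. mball x e \<subseteq> U" by (elim exE conjE)
  define \<epsilon> where "\<epsilon> = (if k > 0 then min e (pi / (2 * sqrt k)) else e)"
  have eps: "0 < \<epsilon>" "\<epsilon> \<le> e" using e by (auto simp: \<epsilon>_def)
  have "below_diam k \<epsilon>"
  proof (cases "k > 0")
    case True
    have "pi / (2 * sqrt k) < pi / sqrt k" using True by (simp add: field_simps)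
    moreover have "\<epsilon> \<le> pi / (2 * sqrt k)" using True by (simp add: \<epsilon>_def)
    ultimately show ?thesis by (simp add: below_diam_def)
  qed (simp add: below_diam_def)
  moreover have "comparison_on (mball x \<epsilon>)" if "x \<in> K" for x
  proof -
    obtain U where U: "U \<in> \<C>" "mball x e \<subseteq> U" using bspec[OF e(2) \<open>x \<in> K\<close>] by (elim bexE)
    have "mball x \<epsilon> \<subseteq> U" using mball_subset_concentric[OF eps(2)] U(2) by (rule subset_trans)
    moreover have "comparison_on U" using U(1) by (simp add: \<C>_def)
    ultimately show ?thesis by (rule comparison_on_subset[rotated])
  qed
  ultimately show ?thesis using eps(1) unfolding comparison_radius_def by (intro exI[of _ \<epsilon>]) simp
qed

lemma comparison_radius_exists: "x \<in> M \<Longrightarrow> \<exists>\<epsilon>. comparison_radius x \<epsilon>"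
  using uniform_comparison_radius[of "{x}"] by auto

text \<open>
  Two geodesics \<open>g\<close> and \<open>h\<close> from a common vertex. Both sides have positive length, so that
  comparison angles are meaningful.
\<close>
definition hinge :: "(real \<Rightarrow> 'a) \<Rightarrow> real \<Rightarrow> (real \<Rightarrow> 'a) \<Rightarrow> real \<Rightarrow> bool" where
  "hinge g a h b \<longleftrightarrow> 0 < a \<and> 0 < b \<and> geod M d g a \<and> geod M d h b \<and> g 0 = h 0"

lemma hinge_commute: "hinge g a h b \<Longrightarrow> hinge h b g a"
  by (simp add: hinge_def)

lemma hinge_mono: "hinge g a h b \<Longrightarrow> 0 < a' \<Longrightarrow> a' \<le> a \<Longrightarrow> 0 < b' \<Longrightarrow> b' \<le> b \<Longrightarrow> hinge g a' h b'"
  by (auto simp: hinge_def intro: geod_mono)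

lemma hinge_points:
  assumes "hinge g a h b"
  shows "g 0 \<in> M" "g a \<in> M" "h b \<in> M" "d (g 0) (g a) = a" "d (g 0) (h b) = b"
    "\<bar>a - b\<bar> \<le> d (g a) (h b)" "d (g a) (h b) \<le> a + b"
proof -
  show M: "g 0 \<in> M" "g a \<in> M" "h b \<in> M" and e: "d (g 0) (g a) = a" "d (g 0) (h b) = b"
    using assms geod_in[of M d g a] geod_in[of M d h b] geod_dist[of M d g a 0 a] geod_dist[of M d h b 0 b]
    unfolding hinge_def by simp_all
  show "\<bar>a - b\<bar> \<le> d (g a) (h b)" "d (g a) (h b) \<le> a + b"
    using triangle[of "g a" "g 0" "h b"] triangle[of "g 0" "g a" "h b"] triangle[of "g 0" "h b" "g a"]
      M e commute[of "g a" "g 0"] commute[of "g a" "h b"] by simp_all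
qed

definition cos_cmp_along :: "(real \<Rightarrow> 'a) \<Rightarrow> (real \<Rightarrow> 'a) \<Rightarrow> real \<Rightarrow> real \<Rightarrow> real" where
  "cos_cmp_along g h s t = cos_cmp k s t (d (g s) (h t))"

lemma cos_cmp_along_commute: "cos_cmp_along g h s t = cos_cmp_along h g t s"
  unfolding cos_cmp_along_def by (simp add: commute cos_cmp_commute)

text \<open>
  The cosine of the angle between two geodesics, which depends only on their germs. The
  diagonal limit suffices because comparison angles are monotone near the vertex.
\<close>
definition cos_angle :: "(real \<Rightarrow> 'a) \<Rightarrow> (real \<Rightarrow> 'a) \<Rightarrow> real" where
  "cos_angle g h = Lim (at_right 0) (\<lambda>t. cos_cmp_along g h t t)"

lemma cos_angle_commute: "cos_angle g h = cos_angle h g"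
  unfolding cos_angle_def by (subst cos_cmp_along_commute) simp

text \<open>
  The end points of the hinge are at most as far apart as in the model plane. Equivalently, the angle
  is at least the comparison angle.
\<close>
definition hinge_comparison :: "(real \<Rightarrow> 'a) \<Rightarrow> real \<Rightarrow> (real \<Rightarrow> 'a) \<Rightarrow> real \<Rightarrow> bool" where
  "hinge_comparison g a h b \<longleftrightarrow> md k (d (g a) (h b)) \<le> third_side k a b (cos_angle g h)"

text \<open>
  Comparison for the point \<open>h b\<close> and the side \<open>g\<close> says exactly that the comparison angle
  grows as the side is cut off at \<open>s\<close>.
\<close>
lemma cos_cmp_along_mono_left:
  assumes rad: "comparison_radius (g 0) \<epsilon>" and hi: "hinge g a h b" and "a + b < \<epsilon>" "0 < s" "s \<le> a"
  shows "cos_cmp_along g h s b \<le> cos_cmp_along g h a b"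
proof -
  note H = hi[unfolded hinge_def]
  note P = hinge_points[OF hi]
  have ok: "below_diam k \<epsilon>" and on: "comparison_on (mball (g 0) \<epsilon>)"
    using rad by (auto simp: comparison_radius_def)
  then have bd: "below_diam k (a + b)" "below_diam k s" "below_diam k b"
    using assms H by (auto simp: below_diam_def)
  have gd: "d (g 0) (g s) = s" "g s \<in> M" using H assms geod_dist[of M d g a 0 s] geod_in[of M d g a s] by auto
  have G: "minimal_geodesic M d (g 0) (g a) (g ` {0..a})"
    using geod_minimal[of M d g a] H Metric_space_axioms by simp
  have sub: "g ` {0..a} \<subseteq> mball (g 0) \<epsilon>"
    using H assms P geod_dist[of M d g a 0] geod_in[of M d g a] by auto
  have p: "h b \<in> mball (g 0) \<epsilon>" using P assms H by simp
  have "k > 0 \<longrightarrow> d (h b) (g 0) + d (h b) (g a) + d (g 0) (g a) < 2 * pi / sqrt k"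
  proof
    assume "k > 0"
    then have "a + b < pi / sqrt k" using bd by (simp add: below_diam_def)
    then show "d (h b) (g 0) + d (h b) (g a) + d (g 0) (g a) < 2 * pi / sqrt k"
      using P commute[of "h b" "g 0"] commute[of "h b" "g a"] by (simp flip: times_divide_eq_right)
  qed
  then have top: "toponogov_comparison k d (h b) (g 0) (g a) (g ` {0..a})"
    using on G sub p unfolding comparison_on_def by blast
  have "d (h b) (g s) \<le> d (g 0) (g s) + d (h b) (g 0)"
    using triangle[of "h b" "g 0" "g s"] P gd by simp
  then have "third_side k s b (cos_cmp_along g h a b) \<le> md k (d (h b) (g s))"
    using toponogov_comparison_third_side[OF top, of "g s"] assms(3-) H P gd bd 
      commute[of "h b" "g 0"] commute[of "h b" "g a"]
    by (simp add: cos_cmp_along_def)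
  then show ?thesis
    using third_side_le_md_iff[of s b k] assms H bd by (simp add: cos_cmp_along_def commute)
qed

lemma cos_cmp_along_mono:
  assumes rad: "comparison_radius (g 0) \<epsilon>" and hi: "hinge g a h b" and "a + b < \<epsilon>" 
    "0 < s" "s \<le> a" "0 < t" "t \<le> b"
  shows "cos_cmp_along g h s t \<le> cos_cmp_along g h a b"
proof -
  have "cos_cmp_along g h s t = cos_cmp_along h g t s" by (rule cos_cmp_along_commute)
  also have "\<dots> \<le> cos_cmp_along h g b s"
  proof (rule cos_cmp_along_mono_left)
    show "comparison_radius (h 0) \<epsilon>" using rad hi by (simp add: hinge_def)
    have "hinge g s h b" using hi assms by (intro hinge_mono[OF hi]) auto
    then show "hinge h b g s" by (rule hinge_commute)
  qed (use assms in auto)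
  also have "\<dots> = cos_cmp_along g h s b" by (rule cos_cmp_along_commute)
  also have "\<dots> \<le> cos_cmp_along g h a b" by (rule cos_cmp_along_mono_left[where g = g, OF rad hi]) (use assms in auto)
  finally show ?thesis .
qed

lemma cos_cmp_along_bounds:
  assumes "hinge g a h b" "below_diam k (a + b)"
  shows "-1 \<le> cos_cmp_along g h a b" "cos_cmp_along g h a b \<le> 1"
  using assms hinge_points[OF assms(1)] unfolding cos_cmp_along_def hinge_def by (auto intro!: cos_cmp_bounds)

lemma cos_angle_tendsto:
  assumes hi: "hinge g a h b"
  shows "((\<lambda>t. cos_cmp_along g h t t) \<longlongrightarrow> cos_angle g h) (at_right 0)"
    and "-1 \<le> cos_angle g h" and "cos_angle g h \<le> 1"
proof -
  obtain \<epsilon> where rad: "comparison_radius (g 0) \<epsilon>"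
    using comparison_radius_exists[OF hinge_points(1)[OF hi]] by blast
  then have e: "0 < \<epsilon>" "below_diam k \<epsilon>" by (auto simp: comparison_radius_def)
  define \<delta> where "\<delta> = min (\<epsilon> / 2) (min a b)"
  have \<delta>: "0 < \<delta>" using e hi by (simp add: \<delta>_def hinge_def)
  have sub: "hinge g t h t" "t + t < \<epsilon>" "below_diam k (t + t)" if "0 < t" "t < \<delta>" for t
    using that hinge_mono[OF hi, of t t] e by (auto simp: \<delta>_def below_diam_def)
  have "((\<lambda>t. cos_cmp_along g h t t) \<longlongrightarrow> Inf ((\<lambda>t. cos_cmp_along g h t t) ` {0<..<\<delta>})) (at_right 0)"
    using \<delta> sub cos_cmp_along_bounds(1) by (intro monotone_tendsto_at_right[where m = "-1"]) (auto intro!: cos_cmp_along_mono[where g = g, OF rad])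
  then show lim: "((\<lambda>t. cos_cmp_along g h t t) \<longlongrightarrow> cos_angle g h) (at_right 0)"
    unfolding cos_angle_def using tendsto_Lim trivial_limit_at_right_real by metis
  have ev: "\<forall>\<^sub>F t in at_right 0. -1 \<le> cos_cmp_along g h t t \<and> cos_cmp_along g h t t \<le> 1"
    using \<delta> sub cos_cmp_along_bounds by (auto simp: eventually_at_right_field)
  show "-1 \<le> cos_angle g h"
    by (rule tendsto_lowerbound[OF lim]) (use ev in \<open>auto elim: eventually_mono\<close>)
  show "cos_angle g h \<le> 1"
    by (rule tendsto_upperbound[OF lim]) (use ev in \<open>auto elim: eventually_mono\<close>)
qed

text \<open>By monotonicity each comparison angle is at most their limit near the vertex, which is the angle.\<close>
lemma hinge_comparison_local:
  assumes rad: "comparison_radius (g 0) \<epsilon>" and hi: "hinge g a h b" and ab: "a + b < \<epsilon>"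
  shows "hinge_comparison g a h b"
proof -
  have p: "0 < a" "0 < b" using hi by (auto simp: hinge_def)
  then have "\<forall>\<^sub>F t in at_right 0. cos_cmp_along g h t t \<le> cos_cmp_along g h a b"
    using cos_cmp_along_mono[where g = g, OF rad hi ab] unfolding eventually_at_right_field 
    by (intro exI[of _ "min a b"]) auto
  then have "cos_angle g h \<le> cos_cmp_along g h a b"
    by (intro tendsto_upperbound[OF cos_angle_tendsto(1)[OF hi]]) auto
  moreover have "below_diam k a" "below_diam k b"
    using rad ab p by (auto simp: comparison_radius_def below_diam_def)
  ultimately show ?thesis
    using md_le_third_side_iff p by (simp add: hinge_comparison_def cos_cmp_along_def)
qed

text \<open>
  Adjacent angles have sum at most \<open>\<pi>\<close>. For comparison angles at small scale \<open>t\<close> this is comparison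
  for the point \<open>h t\<close> and the piece of \<open>g\<close> of length \<open>2 * t\<close> centred at the vertex, and it passes to
  the limit.
\<close>
lemma cos_angle_adjacent:
  assumes g: "geod M d g L" and c: "0 < c" "c < L" and h: "geod M d h b" "0 < b" "h 0 = g c"
  shows "0 \<le> cos_angle (\<lambda>t. g (c + t)) h + cos_angle (\<lambda>t. g (c - t)) h"
proof -
  let ?r = "\<lambda>t. g (c + t)" and ?l = "\<lambda>t. g (c - t)"
  have hr: "hinge ?r (L - c) h b" and hl: "hinge ?l c h b"
    using assms geod_shift[OF g, of c "L - c"] geod_reverse[OF g, of c] by (auto simp: hinge_def)
  obtain \<epsilon> where rad: "comparison_radius (g c) \<epsilon>"
    using comparison_radius_exists[OF hinge_points(1)[OF hr]] by auto
  then have e: "0 < \<epsilon>" "below_diam k \<epsilon>" and on: "comparison_on (mball (g c) \<epsilon>)" by (auto simp: comparison_radius_def)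
  define \<delta> where "\<delta> = Min {\<epsilon> / 4, c, L - c, b}"
  have \<delta>: "0 < \<delta>" using e assms by (simp add: \<delta>_def)
  have pos: "0 \<le> cos_cmp_along ?r h t t + cos_cmp_along ?l h t t" if t: "0 < t" "t < \<delta>" for t
  proof -
    have t': "4 * t < \<epsilon>" "t < c" "t < L - c" "t < b" using t by (auto simp: \<delta>_def)
    have bd: "below_diam k (4 * t)" "below_diam k (t + t)" "below_diam k t" 
      using e t' t by (auto simp: below_diam_def)
    define p q r s where "p = h t" and "q = g (c - t)" and "r = g (c + t)" and "s = g c"
    have M: "p \<in> M" "q \<in> M" "r \<in> M" "s \<in> M"
      using geod_in[OF h(1)] geod_in[OF g] t t' c unfolding p_def q_def r_def s_def by auto
    have ds: "d p s = t" "d q s = t" "d s r = t" "d q r = t + t"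
      using geod_dist[OF h(1), of t 0] geod_dist[OF g] t t' c h(3) unfolding p_def q_def r_def s_def by auto
    have four: "sn k t * (md k (d p q) - md k t) + sn k t * (md k (d p r) - md k t) \<le> sn k (t + t) * md k (d p s)"
    proof (cases "d p q = 0")
      case True
      then have "p = q" using zero M by simp
      then show ?thesis using ds four_point_degenerate[of k t t] True by simp
    next
      case False
      then have A: "0 < d p q" using nonneg[of p q] by linarith
      have tri: "d p q \<le> t + t" "d p r \<le> t + t" "d q r \<le> d p q + d p r" "d p q \<le> d p r + (t + t)" 
        "d p r \<le> d p q + (t + t)" "d p s \<le> d q s + d p q"
        using triangle[of p s q] triangle[of p s r] triangle[of q p r] triangle[of p r q] triangle[of p q r] triangle[of p q s] M ds
        by (simp_all add: commute)
      have geo: "minimal_geodesic M d q r ((\<lambda>v. g ((c - t) + v)) ` {0..t + t})"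
      proof -
        have e: "geod M d (\<lambda>v. g ((c - t) + v)) (t + t)" using geod_shift[OF g] t t' by simp
        have "minimal_geodesic M d (g ((c - t) + 0)) (g ((c - t) + (t + t))) ((\<lambda>v. g ((c - t) + v)) ` {0..t + t})"
          by (rule geod_minimal[OF Metric_space_axioms e]) (use t in simp)
        moreover have "(c - t) + 0 = c - t" "(c - t) + (t + t) = c + t" by simp_all
        ultimately show ?thesis unfolding q_def r_def by (simp only:)
      qed
      have sub: "(\<lambda>v. g ((c - t) + v)) ` {0..t + t} \<subseteq> mball (g c) \<epsilon>"
        using t t' c geod_in[OF g] geod_dist[OF g, of c] by auto
      have "d s p < \<epsilon>" using ds(1) t t' commute[of p s] by linarith
      then have "p \<in> mball (g c) \<epsilon>" using M by (simp add: s_def)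
      moreover have "k > 0 \<longrightarrow> d p q + d p r + d q r < 2 * pi / sqrt k"
        using bd tri ds t by (auto simp: below_diam_def simp flip: times_divide_eq_right)
      ultimately have top: "toponogov_comparison k d p q r ((\<lambda>v. g ((c - t) + v)) ` {0..t + t})"
        using on geo sub unfolding comparison_on_def by blast
      have "s \<in> (\<lambda>v. g ((c - t) + v)) ` {0..t + t}"
        using t by (auto simp: s_def intro!: image_eqI[of _ _ t])
      moreover have bdA: "below_diam k (d q r + d p q)" "below_diam k (d p q)" 
        using bd tri ds t by (auto simp: below_diam_def)
      ultimately have "third_side k t (d p q) (cos_cmp k (t + t) (d p q) (d p r)) \<le> md k (d p s)"
        using toponogov_comparison_third_side[OF top, of s] tri ds t A by simp
      then have "sn k (t + t) * third_side k t (d p q) (cos_cmp k (t + t) (d p q) (d p r)) \<le> sn k (t + t) * md k (d p s)"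
        using sn_nonneg[of "t + t" k] t bd by (intro mult_left_mono) auto
      then show ?thesis
        using four_point_third_side[of t t "d p q" k "d p r"] t A bd bdA by simp
    qed
    have sp: "0 < sn k t" using sn_pos t bd by blast
    have "sn k t * (md k (d p q) + md k (d p r)) \<le> sn k t * (2 * (md k t + md k t * cs k t))"
      using four unfolding ds sn_add by (simp add: algebra_simps)
    then have le: "md k (d p q) + md k (d p r) \<le> 2 * (md k t + md k t * cs k t)"
      using sp by simp
    have "cos_cmp_along ?r h t t + cos_cmp_along ?l h t t = 
      (2 * (md k t + md k t * cs k t) - (md k (d p q) + md k (d p r))) / (sn k t * sn k t)"
      using commute[of p q] commute[of p r]
      by (simp add: cos_cmp_along_def cos_cmp_def p_def q_def r_def flip: add_divide_distrib)
    also have "\<dots> \<ge> 0" using le sp by (intro divide_nonneg_nonneg) auto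
    finally show ?thesis .
  qed
  show ?thesis
  proof (rule tendsto_lowerbound)
    show "((\<lambda>t. cos_cmp_along ?r h t t + cos_cmp_along ?l h t t) \<longlongrightarrow> cos_angle ?r h + cos_angle ?l h) (at_right 0)"
      by (intro tendsto_add cos_angle_tendsto(1)[OF hr] cos_angle_tendsto(1)[OF hl])
    show "\<forall>\<^sub>F t in at_right 0. 0 \<le> cos_cmp_along ?r h t t + cos_cmp_along ?l h t t"
      using pos \<delta> by (auto simp: eventually_at_right_field)
  qed simp
qed

section \<open>From short hinges to long hinges\<close>

text \<open>
  Alexandrov's lemma in \<open>X\<close>. The vertex moves along the side \<open>g\<close> to \<open>g \<delta>\<close>, and \<open>h'\<close> is the new second
  side. The angles at both ends of \<open>[g 0, g \<delta>]\<close> are at least the comparison angles of the thin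
  triangle with vertices \<open>g 0\<close>, \<open>g \<delta>\<close>, \<open>h b\<close>, so the new angle at \<open>g \<delta>\<close> is at most the
  supplement of the comparison angle there. For the comparison angles themselves the two predicted third
  sides agree, by \<open>third_side_extend\<close>.
\<close>
lemma hinge_slide:
  assumes hi: "hinge g a h b" and \<delta>: "0 < \<delta>" "\<delta> < a" and e: "0 < e" "e = d (g \<delta>) (h b)"
    and h': "geod M d h' e" "h' 0 = g \<delta>" "h' e = h b"
    and c1: "hinge_comparison g \<delta> h b" and c2: "hinge_comparison (\<lambda>t. g (\<delta> - t)) \<delta> h' e"
    and bd: "below_diam k a" "below_diam k b" "below_diam k e"
  shows "third_side k (a - \<delta>) e (cos_angle (\<lambda>t. g (\<delta> + t)) h') \<le> third_side k a b (cos_angle g h)"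
proof -
  have H: "0 < a" "0 < b" "geod M d g a" using hi by (auto simp: hinge_def)
  have bd\<delta>: "below_diam k \<delta>" "below_diam k (a - \<delta>)" using bd \<delta> by (auto simp: below_diam_def)
  let ?r = "\<lambda>t. g (\<delta> + t)" and ?l = "\<lambda>t. g (\<delta> - t)"
  have "d (g 0) (h b) = b" using hinge_points[OF hi] by blast
  then have l: "cos_angle ?l h' \<le> cos_cmp k \<delta> e b"
    using c2 md_le_third_side_iff[of \<delta> e k] \<delta> e bd bd\<delta> h' by (simp add: hinge_comparison_def)
  have g: "cos_angle g h \<le> cos_cmp k \<delta> b e"
    using c1 md_le_third_side_iff[of \<delta> b k] \<delta> H bd bd\<delta> e by (simp add: hinge_comparison_def)
  have "0 \<le> cos_angle ?r h' + cos_angle ?l h'"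
    using cos_angle_adjacent[OF H(3) \<delta> h'(1) e(1) h'(2)] .
  then have "- cos_cmp k \<delta> e b \<le> cos_angle ?r h'" using l by linarith
  then have "third_side k (a - \<delta>) e (cos_angle ?r h') \<le> third_side k (a - \<delta>) e (- cos_cmp k \<delta> e b)"
    using \<delta> e bd bd\<delta> by (intro third_side_antimono) auto
  also have "\<dots> = third_side k a b (cos_cmp k \<delta> b e)"
    using third_side_extend[of \<delta> b e k "a - \<delta>"] \<delta> H e bd bd\<delta> by simp
  also have "\<dots> \<le> third_side k a b (cos_angle g h)"
    using g H bd by (intro third_side_antimono) auto
  finally show ?thesis .
qed

text \<open>
  In an unbounded space the local scale of comparison may tend to 0 at infinity. Hence the restriction of
  the vertex to a ball.
\<close>
definition hinges_compare :: "real \<Rightarrow> 'a \<Rightarrow> real \<Rightarrow> bool" where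
  "hinges_compare l z R \<longleftrightarrow>
     (\<forall>g a h b. hinge g a h b \<and> d z (g 0) < R \<and> a + b < l \<longrightarrow> hinge_comparison g a h b)"

lemma md_lipschitz:
  assumes "0 < l"
  obtains K where "0 < K" "\<And>x. 0 \<le> x \<Longrightarrow> x \<le> l \<Longrightarrow> sn k x \<le> K"
    "\<And>x y. 0 \<le> x \<Longrightarrow> x \<le> y \<Longrightarrow> y \<le> l \<Longrightarrow> md k y - md k x \<le> K * (y - x)"
proof -
  have "compact (sn k ` {0..l})" by (intro compact_continuous_image continuous_intros) auto
  then obtain K where K: "0 < K" "\<And>x. x \<in> {0..l} \<Longrightarrow> \<bar>sn k x\<bar> \<le> K"
    using compact_imp_bounded bounded_pos[of "sn k ` {0..l}"] by auto
  have "md k y - md k x \<le> K * (y - x)" if "0 \<le> x" "x \<le> y" "y \<le> l" for x y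
  proof (cases "x = y")
    case False
    then have "x < y" using that by simp
    then have "\<exists>z>x. z < y \<and> md k y - md k x = (y - x) * sn k z"
      by (rule MVT2) (rule DERIV_md)
    then obtain z where "x < z" "z < y" "md k y - md k x = (y - x) * sn k z" by blast
    then show ?thesis using K(2)[of z] that by (simp add: mult.commute[of K] mult_left_mono)
  qed simp
  moreover have "sn k x \<le> K" if "0 \<le> x" "x \<le> l" for x using K(2)[of x] that by simp
  ultimately show ?thesis using that K(1) by blast
qed

text \<open>
  The descent step. If the model predicts at most \<open>m\<close> for a hinge whose end points are in fact further apart,
  then there is a shorter hinge with the same end points and a prediction of at most \<open>m\<close>, and the loss of
  length is bounded below in terms of the end points, \<open>m\<close> and \<open>l\<close> only. The vertex is moved by
  \<open>\<delta> = l / 20\<close>, so that the auxiliary hinges have sizes at most \<open>\<delta> + b\<close> and \<open>2 * \<delta> + b\<close>, which are below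
  \<open>2 / 3 * l\<close> since \<open>b < l / 2\<close>.

  The prediction is \<open>md k (a + b)\<close> minus \<open>sn k a * w\<close>, where \<open>w = sn k b * (1 + cos \<alpha>)\<close> for the angle
  \<open>\<alpha>\<close> at the vertex. Comparison for the hinge with sides \<open>\<delta>\<close> and \<open>b\<close> bounds \<open>w\<close> by a
  multiple of the loss of length \<open>\<delta> + b - e\<close>. The factor \<open>sn k b\<close> in \<open>w\<close> makes this bound uniform
  in \<open>b\<close>, however short the second side is.
\<close>
lemma hinge_shrink:
  assumes short: "hinges_compare (2 / 3 * l) z R" and l: "0 < l" "k > 0 \<Longrightarrow> l \<le> pi / sqrt k"
    and hi: "hinge g a h b" and near: "d z (g a) < R - l" and zM: "z \<in> M"
    and ab: "b \<le> a" "a + b < l"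
    and m: "third_side k a b (cos_angle g h) \<le> m" "m < md k (d (g a) (h b))"
    and K: "0 < K" "\<And>x. 0 \<le> x \<Longrightarrow> x \<le> l \<Longrightarrow> sn k x \<le> K"
      "\<And>x y. 0 \<le> x \<Longrightarrow> x \<le> y \<Longrightarrow> y \<le> l \<Longrightarrow> md k y - md k x \<le> K * (y - x)"
  shows "\<exists>g' a' h' b'. hinge g' a' h' b' \<and> g' a' = g a \<and> h' b' = h b \<and>
    third_side k a' b' (cos_angle g' h') \<le> m \<and> 
    a' + b' \<le> a + b - (md k (d (g a) (h b)) - m) * sn k (l / 20) / K\<^sup>2"
proof -
  define \<delta> where "\<delta> = l / 20"
  define e where "e = d (g \<delta>) (h b)"
  define D where "D = d (g a) (h b)"
  note H = hi[unfolded hinge_def]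
  note P = hinge_points[OF hi]
  have near': "d z x < R" if "x \<in> M" "d x (g a) \<le> l" for x
    using triangle[of z "g a" x] that P zM near by (simp add: commute)
  have not: "\<not> hinge_comparison g a h b" using m by (auto simp: hinge_comparison_def)
  have "2 / 3 * l \<le> a + b"
    using short hi not near'[of "g 0"] P ab H unfolding hinges_compare_def by force
  then have \<delta>: "0 < \<delta>" "\<delta> < a" "\<delta> + b < 2 / 3 * l" "2 * \<delta> + b < 2 / 3 * l"
    using ab l by (auto simp: \<delta>_def)
  have bd: "below_diam k x" if "x < l" for x using l that by (auto simp: below_diam_def)
  have hi1: "hinge g \<delta> h b" using hinge_mono[OF hi] \<delta> H by simp
  note P1 = hinge_points[OF hi1]
  have x0: "d z (g 0) < R" using near'[of "g 0"] P H ab by simp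
  have c1: "hinge_comparison g \<delta> h b" 
    using short hi1 x0 \<delta> unfolding hinges_compare_def by blast
  have eb: "e \<le> \<delta> + b" "0 \<le> e" using P1 by (auto simp: e_def)
  have D1: "d (g \<delta>) (g a) = a - \<delta>" using geod_dist[of M d g a \<delta> a] H \<delta> by simp
  have sa: "0 < sn k a" "0 < sn k b" "0 < sn k \<delta>" using sn_pos bd H ab \<delta> by auto
  have e0: "0 < e"
  proof (rule ccontr)
    assume "\<not> 0 < e"
    then have "e = 0" using eb by simp
    then have "g \<delta> = h b" using P1 zero by (simp add: e_def)
    then have "b = \<delta>" "D = a - \<delta>" using P1 D1 commute[of "h b" "g a"] by (auto simp: D_def)
    moreover have "md k (a - b) \<le> third_side k a b (cos_angle g h)"
      using cos_angle_tendsto(3)[OF hi] sa by (simp add: third_side_eq_diff)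
    ultimately show False using m by (simp add: D_def)
  qed
  obtain h' where h': "geod M d h' e" "h' 0 = g \<delta>" "h' e = h b"
    using geodesic_exists[OF P1(2,3)] unfolding e_def by blast
  have gl: "geod M d (\<lambda>t. g (\<delta> - t)) \<delta>" and gr: "geod M d (\<lambda>t. g (\<delta> + t)) (a - \<delta>)"
    using geod_reverse[of M d g a \<delta>] geod_shift[of M d g a \<delta> "a - \<delta>"] H \<delta> by auto
  have hl: "hinge (\<lambda>t. g (\<delta> - t)) \<delta> h' e" and hr: "hinge (\<lambda>t. g (\<delta> + t)) (a - \<delta>) h' e"
    using gl gr h' \<delta> e0 by (auto simp: hinge_def)
  have "d z (g \<delta>) < R" using near'[of "g \<delta>"] P1 D1 ab H \<delta> by simp
  moreover have "\<delta> + e < 2 / 3 * l" using eb \<delta> by simp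
  ultimately have c2: "hinge_comparison (\<lambda>t. g (\<delta> - t)) \<delta> h' e"
    using short hl unfolding hinges_compare_def by auto
  have slide: "third_side k (a - \<delta>) e (cos_angle (\<lambda>t. g (\<delta> + t)) h') \<le> third_side k a b (cos_angle g h)"
  proof (rule hinge_slide[OF hi \<delta>(1,2) e0 e_def h' c1 c2])
    show "below_diam k a" "below_diam k b" "below_diam k e" using bd ab H eb \<delta> l by auto
  qed
  define w where "w = sn k b * (1 + cos_angle g h)"
  have w0: "0 \<le> w" using cos_angle_tendsto(2)[OF hi] sa by (simp add: w_def)
  have "md k e \<le> md k (\<delta> + b) - sn k \<delta> * w"
    using c1 by (simp add: hinge_comparison_def third_side_eq_add e_def w_def mult.assoc)
  then have w: "sn k \<delta> * w \<le> K * (\<delta> + b - e)"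
    using K(3)[of e "\<delta> + b"] eb \<delta> l by simp
  have "md k D \<le> md k (a + b)"
    using P ab H l by (intro md_mono) (auto simp: D_def)
  moreover have "md k (a + b) - sn k a * w \<le> m"
    using m(1) by (simp add: third_side_eq_add w_def mult.assoc)
  moreover have "sn k a * w \<le> K * w" using K(2)[of a] w0 ab H by (intro mult_right_mono) auto
  ultimately have "md k D - m \<le> K * w" by linarith
  then have "(md k D - m) * sn k \<delta> \<le> K * w * sn k \<delta>" using sa by (intro mult_right_mono) auto
  also have "\<dots> \<le> K * (K * (\<delta> + b - e))" using w K(1) mult_left_mono[OF w, of K] by (simp add: mult_ac)
  finally have "(md k D - m) * sn k \<delta> / K\<^sup>2 \<le> \<delta> + b - e"
    using K(1) by (simp add: field_simps power2_eq_square)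
  then have dec: "(a - \<delta>) + e \<le> a + b - (md k D - m) * sn k \<delta> / K\<^sup>2" by linarith
  have fin: "(\<lambda>t. g (\<delta> + t)) (a - \<delta>) = g a" by simp
  show ?thesis
    using hr fin h'(3) slide m(1) dec unfolding D_def \<delta>_def
    by (intro exI[of _ "\<lambda>t. g (l / 20 + t)"] exI[of _ "a - l / 20"] exI[of _ h'] exI[of _ e]) auto
qed

text \<open>
  The descent started at a counterexample stays among hinges with the same two end points and
  size below \<open>l\<close>, so all its vertices are within \<open>2 * l\<close> of the first one. The sizes of these
  hinges have an infimum, which contradicts the definite decrease.
\<close>
lemma hinges_compare_extend:
  assumes short: "hinges_compare (2 / 3 * l) z R" and l: "0 < l" "k > 0 \<Longrightarrow> l \<le> pi / sqrt k" and zM: "z \<in> M"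
  shows "hinges_compare l z (R - 2 * l)"
  unfolding hinges_compare_def
proof (intro allI impI, rule ccontr, elim conjE)
  fix g a h b
  assume hi: "hinge g a h b" and near: "d z (g 0) < R - 2 * l" and ab: "a + b < l" 
    and not: "\<not> hinge_comparison g a h b"
  define p q m where "p = g a" and "q = h b" and "m = third_side k a b (cos_angle g h)"
  have m: "m < md k (d p q)" using not by (simp add: hinge_comparison_def p_def q_def m_def)
  have P: "g 0 \<in> M" "p \<in> M" "q \<in> M" "d (g 0) p = a" "d (g 0) q = b" 
    using hinge_points[OF hi] by (auto simp: p_def q_def)
  have pq: "d z p < R - l" "d z q < R - l"
    using triangle[of z "g 0" p] triangle[of z "g 0" q] P zM near ab hi by (auto simp: hinge_def)
  obtain K where K: "0 < K" "\<And>x. 0 \<le> x \<Longrightarrow> x \<le> l \<Longrightarrow> sn k x \<le> K"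
    "\<And>x y. 0 \<le> x \<Longrightarrow> x \<le> y \<Longrightarrow> y \<le> l \<Longrightarrow> md k y - md k x \<le> K * (y - x)"
    using md_lipschitz[OF l(1)] by blast
  define c where "c = (md k (d p q) - m) * sn k (l / 20) / K\<^sup>2"
  have "below_diam k (l / 20)"
    unfolding below_diam_def
  proof
    assume "k > 0"
    then have "l \<le> pi / sqrt k" by (rule l(2))
    then show "l / 20 < pi / sqrt k" using l(1) by linarith
  qed
  then have "0 < sn k (l / 20)" using l(1) by (intro sn_pos) auto
  then have c: "0 < c" using m K by (simp add: c_def)
  define S where "S = {s. \<exists>g a h b. hinge g a h b \<and> ((g a = p \<and> h b = q) \<or> (g a = q \<and> h b = p)) \<and>
     third_side k a b (cos_angle g h) \<le> m \<and> s = a + b \<and> s < l}"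
  have decrease: "\<exists>s'\<in>S. s' \<le> s - c" if s: "s \<in> S" for s
  proof -
    obtain g1 a1 h1 b1 where 1: "hinge g1 a1 h1 b1" "(g1 a1 = p \<and> h1 b1 = q) \<or> (g1 a1 = q \<and> h1 b1 = p)"
      "third_side k a1 b1 (cos_angle g1 h1) \<le> m" "s = a1 + b1" "s < l"
      using s unfolding S_def by blast
    \<comment> \<open>The roles of \<open>p\<close> and \<open>q\<close> may be exchanged, so let the first side be the longer one.\<close>
    have "\<exists>g a h b. hinge g a h b \<and> ((g a = p \<and> h b = q) \<or> (g a = q \<and> h b = p)) \<and>
      third_side k a b (cos_angle g h) \<le> m \<and> s = a + b \<and> b \<le> a"
    proof (cases "b1 \<le> a1")
      case True
      then show ?thesis using 1 by blast
    next
      case False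
      have "third_side k b1 a1 (cos_angle h1 g1) \<le> m"
        using 1(3) by (simp add: third_side_commute[of k b1] cos_angle_commute[of h1])
      then show ?thesis using 1 False hinge_commute[OF 1(1)]
        by (intro exI[of _ h1] exI[of _ b1] exI[of _ g1] exI[of _ a1]) auto
    qed
    then obtain g2 a2 h2 b2 where 2: "hinge g2 a2 h2 b2" "(g2 a2 = p \<and> h2 b2 = q) \<or> (g2 a2 = q \<and> h2 b2 = p)"
      "third_side k a2 b2 (cos_angle g2 h2) \<le> m" "s = a2 + b2" "b2 \<le> a2" by blast
    have d2: "d (g2 a2) (h2 b2) = d p q" using 2(2) commute by auto
    have n2: "d z (g2 a2) < R - l" using 2(2) pq by auto
    have l2: "a2 + b2 < l" using 1 2 by simp
    have m2: "m < md k (d (g2 a2) (h2 b2))" using d2 m by simp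
    obtain g3 a3 h3 b3 where 3: "hinge g3 a3 h3 b3" "g3 a3 = g2 a2" "h3 b3 = h2 b2"
      "third_side k a3 b3 (cos_angle g3 h3) \<le> m" "a3 + b3 \<le> s - c"
      using hinge_shrink[OF short l 2(1) n2 zM 2(5) l2 2(3) m2 K] unfolding d2 c_def 2(4) by blast
    have "a3 + b3 \<in> S"
      unfolding S_def using 3 2(2) 1(5) c
      by (intro CollectI exI[of _ g3] exI[of _ a3] exI[of _ h3] exI[of _ b3]) auto
    then show ?thesis using 3(5) by blast
  qed
  have ne: "S \<noteq> {}" using hi ab unfolding S_def p_def q_def m_def by blast
  have "0 \<le> s" if "s \<in> S" for s using that by (auto simp: S_def hinge_def)
  then have bdd: "bdd_below S" by (rule bdd_belowI)
  obtain s where s: "s \<in> S" "s < Inf S + c" using cInf_lessD[OF ne, of "Inf S + c"] c by auto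
  then obtain s' where "s' \<in> S" "s' \<le> s - c" using decrease by blast
  then show False using cInf_lower[OF _ bdd, of s'] s(2) by linarith
qed

text \<open>
  Comparison holds below a uniform scale \<open>\<epsilon>\<close> on the compact ball of radius \<open>7 * l\<close> around the vertex.
  Extending from \<open>(2 / 3) ^ n * l < \<epsilon>\<close> up to \<open>l\<close> costs less than
  \<open>2 * l * (1 + 2 / 3 + (2 / 3)\<^sup>2 + \<dots>) = 6 * l\<close> of this radius.
\<close>
theorem hinge_comparison_global:
  assumes hi: "hinge g a h b" and bd: "below_diam k (a + b)"
  shows "hinge_comparison g a h b"
proof -
  define l where "l = (if k > 0 then pi / sqrt k else a + b + 1)"
  have l: "a + b < l" "k > 0 \<Longrightarrow> l \<le> pi / sqrt k" using bd by (auto simp: l_def below_diam_def)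
  have l0: "0 < l" using l hi by (auto simp: hinge_def)
  define z where "z = g 0"
  have z: "z \<in> M" using hinge_points[OF hi] by (simp add: z_def)
  have step: "hinges_compare l z (R - 6 * l * (1 - (2 / 3) ^ n))" if "hinges_compare ((2 / 3) ^ n * l) z R" for n R
    using that
  proof (induction n arbitrary: R)
    case (Suc n)
    have "(2 / 3) ^ n * l \<le> l" using l0 by (simp add: power_le_one mult_left_le_one_le)
    then have "k > 0 \<Longrightarrow> (2 / 3) ^ n * l \<le> pi / sqrt k" using l by linarith
    moreover have "hinges_compare (2 / 3 * ((2 / 3) ^ n * l)) z R" using Suc.prems by (simp add: mult.assoc)
    ultimately have "hinges_compare ((2 / 3) ^ n * l) z (R - 2 * ((2 / 3) ^ n * l))"
      using l0 z by (intro hinges_compare_extend) auto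
    from Suc.IH[OF this] show ?case by (simp add: algebra_simps)
  qed simp
  obtain \<epsilon> where \<epsilon>: "0 < \<epsilon>" "\<forall>x\<in>mcball z (7 * l). comparison_radius x \<epsilon>"
    using uniform_comparison_radius[OF compact_mcball[OF z]] by blast
  obtain n where n: "(2 / 3) ^ n < \<epsilon> / l"
    using real_arch_pow_inv[of "\<epsilon> / l" "2 / 3"] \<epsilon> l0 by auto
  have "hinges_compare ((2 / 3) ^ n * l) z (7 * l)"
    unfolding hinges_compare_def
  proof (intro allI impI, elim conjE)
    fix g a h b assume *: "hinge g a h b" "d z (g 0) < 7 * l" "a + b < (2 / 3) ^ n * l"
    have "comparison_radius (g 0) \<epsilon>" using \<epsilon>(2) * z hinge_points(1)[OF *(1)] by simp
    moreover have "a + b < \<epsilon>" using *(3) n l0 by (simp add: pos_less_divide_eq)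
    ultimately show "hinge_comparison g a h b" using hinge_comparison_local[of g] * by blast
  qed
  from step[OF this] have "hinges_compare l z (7 * l - 6 * l * (1 - (2 / 3) ^ n))" .
  moreover have "0 < 7 * l - 6 * l * (1 - (2 / 3) ^ n)"
    using l0 by (simp add: algebra_simps add_pos_pos)
  moreover have "d z (g 0) = 0" using z by (simp add: z_def)
  ultimately show ?thesis using hi l(1) unfolding hinges_compare_def by simp
qed

end

section \<open>A maximum principle\<close>

text \<open>
  A Sturm comparison: a continuous function with \<open>g'' + k g \<le> 0\<close>, in the sense of small symmetric
  differences, that is nonnegative at the ends of an interval shorter than the diameter is nonnegative
  throughout. Dividing by the positive solution \<open>w\<close> of \<open>w'' + k w = 0\<close> turns the
  hypothesis into the statement that \<open>g / w\<close> is at least a weighted mean of its neighbouring values. At the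
  leftmost point of a negative minimum this is impossible.
\<close>
lemma midpoint_concave_nonneg:
  fixes g :: "real \<Rightarrow> real"
  assumes L: "0 < L" "below_diam k L" and cont: "continuous_on {0..L} g" and ends: "0 \<le> g 0" "0 \<le> g L"
    and mid: "\<And>t. 0 < t \<Longrightarrow> t < L \<Longrightarrow>
      \<exists>\<delta>>0. \<forall>\<epsilon>. 0 < \<epsilon> \<and> \<epsilon> < \<delta> \<longrightarrow> g (t - \<epsilon>) + g (t + \<epsilon>) \<le> 2 * cs k \<epsilon> * g t"
    and t: "0 \<le> t" "t \<le> L"
  shows "0 \<le> g t"
proof (rule ccontr)
  assume neg: "\<not> 0 \<le> g t"
  define w where "w s = cs k (s - L / 2)" for s
  have w: "0 < w s" if "s \<in> {0..L}" for s
    unfolding w_def using that by (intro cs_half_pos[OF L(2)]) (auto simp: abs_real_def)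
  have w_mid: "w (s - \<epsilon>) + w (s + \<epsilon>) = 2 * cs k \<epsilon> * w s" for s \<epsilon>
  proof -
    have "s - \<epsilon> - L / 2 = (s - L / 2) - \<epsilon>" "s + \<epsilon> - L / 2 = (s - L / 2) + \<epsilon>" by simp_all
    then show ?thesis unfolding w_def by (simp only: cs_add cs_diff) (simp add: algebra_simps)
  qed
  define f where "f s = g s / w s" for s
  have cf: "continuous_on {0..L} f"
    unfolding f_def w_def
  proof (rule continuous_on_divide[OF cont])
    show "continuous_on {0..L} (\<lambda>s. cs k (s - L / 2))" by (intro continuous_intros)
    show "\<forall>s\<in>{0..L}. cs k (s - L / 2) \<noteq> 0"
    proof
      fix s assume "s \<in> {0..L}"
      then show "cs k (s - L / 2) \<noteq> 0" using w[of s] unfolding w_def by linarith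
    qed
  qed
  have "{0..L} \<noteq> {}" using L by simp
  from continuous_attains_inf[OF compact_Icc this cf]
  obtain s0 where "s0 \<in> {0..L}" "\<forall>s\<in>{0..L}. f s0 \<le> f s" by (elim bexE)
  then have s0: "s0 \<in> {0..L}" "\<And>s. s \<in> {0..L} \<Longrightarrow> f s0 \<le> f s" by simp_all
  define A where "A = {s \<in> {0..L}. f s = f s0}"
  have "closed A" unfolding A_def using cf by (intro continuous_closed_preimage_constant) auto
  moreover have "bounded A" by (rule bounded_subset[of "{0..L}"]) (auto simp: A_def)
  ultimately have "compact A" using compact_eq_bounded_closed by blast
  moreover have "A \<noteq> {}" using s0 by (auto simp: A_def)
  ultimately have "\<exists>a\<in>A. \<forall>s\<in>A. a \<le> s" by (rule compact_attains_inf)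
  then obtain a where a: "a \<in> A" "\<And>s. s \<in> A \<Longrightarrow> a \<le> s" by blast
  have fa: "f a = f s0" "a \<in> {0..L}" using a by (auto simp: A_def)
  have "f t < 0" using neg w[of t] t by (simp add: f_def divide_neg_pos)
  then have fneg: "f a < 0" using s0(2)[of t] t fa by simp
  have "a \<noteq> 0" "a \<noteq> L"
    using fneg ends w[of 0] w[of L] L by (auto simp: f_def divide_less_0_iff)
  then have a0: "0 < a" "a < L" using fa by auto
  obtain \<delta> where \<delta>: "\<delta> > 0" "\<And>\<epsilon>. 0 < \<epsilon> \<Longrightarrow> \<epsilon> < \<delta> \<Longrightarrow> g (a - \<epsilon>) + g (a + \<epsilon>) \<le> 2 * cs k \<epsilon> * g a"
    using mid[OF a0] by (elim exE conjE) simp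
  define \<epsilon> where "\<epsilon> = min (\<delta> / 2) (min a (L - a))"
  have \<epsilon>: "0 < \<epsilon>" "\<epsilon> < \<delta>" "a - \<epsilon> \<in> {0..L}" "a + \<epsilon> \<in> {0..L}" using \<delta>(1) a0 by (auto simp: \<epsilon>_def)
  have gf: "g s = f s * w s" if "s \<in> {0..L}" for s using w[OF that] by (simp add: f_def)
  have "f (a - \<epsilon>) * w (a - \<epsilon>) + f (a + \<epsilon>) * w (a + \<epsilon>) \<le> f a * (2 * cs k \<epsilon> * w a)"
    using \<delta>(2)[OF \<epsilon>(1,2)] gf[OF \<epsilon>(3)] gf[OF \<epsilon>(4)] gf[OF fa(2)] by (simp add: mult_ac)
  also have "\<dots> = f a * w (a - \<epsilon>) + f a * w (a + \<epsilon>)"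
    unfolding w_mid[symmetric] by (simp add: distrib_left)
  finally have "f (a - \<epsilon>) * w (a - \<epsilon>) + f (a + \<epsilon>) * w (a + \<epsilon>) \<le> f a * w (a - \<epsilon>) + f a * w (a + \<epsilon>)" .
  moreover have "f a * w (a + \<epsilon>) \<le> f (a + \<epsilon>) * w (a + \<epsilon>)"
    using s0(2)[OF \<epsilon>(4)] fa w[OF \<epsilon>(4)] by (intro mult_right_mono) auto
  ultimately have "f (a - \<epsilon>) * w (a - \<epsilon>) \<le> f a * w (a - \<epsilon>)" by linarith
  then have "f (a - \<epsilon>) \<le> f a" using w[OF \<epsilon>(3)] by simp
  then have "a - \<epsilon> \<in> A" using s0(2)[OF \<epsilon>(3)] fa \<epsilon>(3) by (simp add: A_def)
  then show False using a(2) \<epsilon>(1) by fastforce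
qed

section \<open>The comparison theorem\<close>

context alexandrov
begin

text \<open>
  The differential inequality \<open>f'' + k f \<le> 1\<close> for \<open>f t = md k (d p (g t))\<close> in terms of symmetric
  differences: hinge comparison on both sides of \<open>g t\<close>, where the two angle terms have nonpositive
  contribution by \<open>cos_angle_adjacent\<close>. If \<open>d p (g t)\<close> is below the diameter, then so are the
  sizes of both hinges for small \<open>\<epsilon>\<close>.
\<close>
lemma md_dist_midpoint:
  assumes g: "geod M d g L" and t: "0 < t" "t < L" and p: "p \<in> M" and bd: "below_diam k (d p (g t) + \<epsilon>)"
    and \<epsilon>: "0 < \<epsilon>" "\<epsilon> \<le> t" "\<epsilon> \<le> L - t"
  shows "md k (d p (g (t - \<epsilon>))) + md k (d p (g (t + \<epsilon>))) \<le> 2 * cs k \<epsilon> * md k (d p (g t)) + 2 * md k \<epsilon>"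
proof (cases "d p (g t) = 0")
  case True
  have "g t \<in> M" using geod_in[OF g] t by simp
  then have "p = g t" using True zero p by simp
  then show ?thesis using True geod_dist[OF g, of t "t - \<epsilon>"] geod_dist[OF g, of t "t + \<epsilon>"] t \<epsilon> by simp
next
  case False
  define D where "D = d p (g t)"
  have D: "0 < D" using False nonneg[of p "g t"] unfolding D_def by linarith
  have gt: "g t \<in> M" using geod_in[OF g] t by simp
  obtain h where h: "geod M d h D" "h 0 = g t" "h D = p"
    using geodesic_exists[OF gt p] unfolding D_def by (metis commute)
  let ?r = "\<lambda>u. g (t + u)" and ?l = "\<lambda>u. g (t - u)"
  have "hinge ?r \<epsilon> h D" "hinge ?l \<epsilon> h D"
    using geod_shift[OF g, of t \<epsilon>] geod_mono[OF geod_reverse[OF g, of t]] h D \<epsilon> t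
    by (auto simp: hinge_def)
  moreover have "below_diam k (\<epsilon> + D)" using bd by (simp add: D_def add.commute)
  ultimately have "hinge_comparison ?r \<epsilon> h D" "hinge_comparison ?l \<epsilon> h D"
    using hinge_comparison_global by blast+
  then have r: "md k (d p (g (t + \<epsilon>))) \<le> third_side k \<epsilon> D (cos_angle ?r h)"
    and l: "md k (d p (g (t - \<epsilon>))) \<le> third_side k \<epsilon> D (cos_angle ?l h)"
    unfolding hinge_comparison_def h(3) by (simp_all only: commute[of p])
  have "0 \<le> cos_angle ?r h + cos_angle ?l h"
    using cos_angle_adjacent[OF g t h(1) D h(2)] .
  moreover have "below_diam k \<epsilon>" "below_diam k D" using bd D \<epsilon> by (auto simp: D_def below_diam_def)
  then have "0 \<le> sn k \<epsilon> * sn k D" using sn_nonneg D \<epsilon> by simp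
  ultimately have "0 \<le> sn k \<epsilon> * sn k D * (cos_angle ?r h + cos_angle ?l h)" by simp
  then show ?thesis
    using r l unfolding third_side_def D_def[symmetric] by (simp add: algebra_simps)
qed

text \<open>
  The function \<open>m\<close> in the proof is the solution of \<open>m'' + k m = 1\<close> with the boundary values of
  \<open>f t = md k (d p (g t))\<close>, that is, \<open>md k\<close> of the distance in the comparison triangle. The bound on the
  perimeter keeps all distances \<open>d p (g t)\<close> below the diameter, and the maximum principle applies to
  \<open>f - m\<close>.
\<close>
theorem four_point_global:
  assumes p: "p \<in> M" and g: "geod M d g L" and L: "0 < L" "below_diam k L"
    and per: "k > 0 \<longrightarrow> d p (g 0) + d p (g L) + L < 2 * pi / sqrt k" and t: "0 \<le> t" "t \<le> L"
  shows "sn k (L - t) * (md k (d p (g 0)) - md k t) + sn k t * (md k (d p (g L)) - md k (L - t))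
    \<le> sn k L * md k (d p (g t))"
proof -
  define f where "f t = md k (d p (g t))" for t
  define m where "m t = (sn k (L - t) * (f 0 - md k t) + sn k t * (f L - md k (L - t))) / sn k L" for t
  have sL: "0 < sn k L" using sn_pos L by blast
  have gM: "g u \<in> M" if "u \<in> {0..L}" for u using geod_in[OF g] that by simp
  have lip: "\<bar>d p (g u) - d p (g v)\<bar> \<le> \<bar>u - v\<bar>" if "u \<in> {0..L}" "v \<in> {0..L}" for u v
    using triangle[of p "g u" "g v"] triangle[of p "g v" "g u"] gM[OF that(1)] gM[OF that(2)] p
      geod_dist[OF g, of u v] geod_dist[OF g, of v u] that by auto
  have "continuous_on {0..L} (\<lambda>u. d p (g u))"
    unfolding continuous_on_iff
  proof (intro ballI allI impI)
    fix u e :: real assume "u \<in> {0..L}" "0 < e"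
    moreover have "dist (d p (g v)) (d p (g u)) < e" if "v \<in> {0..L}" "dist v u < e" for v
      using lip[OF that(1) \<open>u \<in> {0..L}\<close>] that(2) unfolding dist_real_def by linarith
    ultimately show "\<exists>\<delta>>0. \<forall>v\<in>{0..L}. dist v u < \<delta> \<longrightarrow> dist (d p (g v)) (d p (g u)) < e"
      by blast
  qed
  then have cont: "continuous_on {0..L} (\<lambda>u. f u - m u)"
    unfolding f_def m_def using sL by (intro continuous_intros) auto
  have m0: "m 0 = f 0" "m L = f L" using sL by (simp_all add: m_def)
  have m_mid: "m (u - \<epsilon>) + m (u + \<epsilon>) = 2 * cs k \<epsilon> * m u + 2 * md k \<epsilon>" for u \<epsilon>
  proof -
    define v where "v = L - u"
    have e: "L - (u - \<epsilon>) = v + \<epsilon>" "L - (u + \<epsilon>) = v - \<epsilon>" "L - u = v" by (simp_all add: v_def)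
    have sL': "sn k L = sn k (u + v)" by (simp add: v_def)
    have E: "(sn k (v + \<epsilon>) * (f 0 - md k (u - \<epsilon>)) + sn k (u - \<epsilon>) * (f L - md k (v + \<epsilon>))) +
       (sn k (v - \<epsilon>) * (f 0 - md k (u + \<epsilon>)) + sn k (u + \<epsilon>) * (f L - md k (v - \<epsilon>))) =
       2 * cs k \<epsilon> * (sn k v * (f 0 - md k u) + sn k u * (f L - md k v)) + 2 * md k \<epsilon> * sn k L"
      using sn_square[of k \<epsilon>] unfolding sL' sn_add sn_diff md_add md_diff by algebra
    show ?thesis
      unfolding m_def e add_divide_distrib[symmetric] E using sL by (simp add: field_simps)
  qed
  have mid: "\<exists>\<delta>>0. \<forall>\<epsilon>. 0 < \<epsilon> \<and> \<epsilon> < \<delta> \<longrightarrow>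
      (f (u - \<epsilon>) - m (u - \<epsilon>)) + (f (u + \<epsilon>) - m (u + \<epsilon>)) \<le> 2 * cs k \<epsilon> * (f u - m u)"
    if u: "0 < u" "u < L" for u
  proof -
    have "d p (g u) \<le> d p (g 0) + u" "d p (g u) \<le> d p (g L) + (L - u)"
      using lip[of 0 u] lip[of L u] u by auto
    then have bd: "below_diam k (d p (g u))" using per by (auto simp: below_diam_def simp flip: times_divide_eq_right)
    define \<delta> where "\<delta> = Min {u, L - u, if k > 0 then pi / sqrt k - d p (g u) else 1}"
    have \<delta>: "0 < \<delta>" using u bd by (auto simp: \<delta>_def below_diam_def)
    have "(f (u - \<epsilon>) - m (u - \<epsilon>)) + (f (u + \<epsilon>) - m (u + \<epsilon>)) \<le> 2 * cs k \<epsilon> * (f u - m u)"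
      if "0 < \<epsilon>" "\<epsilon> < \<delta>" for \<epsilon>
    proof -
      have "below_diam k (d p (g u) + \<epsilon>)" "\<epsilon> \<le> u" "\<epsilon> \<le> L - u"
        using that by (auto simp: \<delta>_def below_diam_def)
      then have "f (u - \<epsilon>) + f (u + \<epsilon>) \<le> 2 * cs k \<epsilon> * f u + 2 * md k \<epsilon>"
        using md_dist_midpoint[OF g u p] that by (simp add: f_def)
      then show ?thesis using m_mid[of u \<epsilon>] by (simp add: algebra_simps)
    qed
    then show ?thesis using \<delta> by blast
  qed
  have "0 \<le> f t - m t"
    by (rule midpoint_concave_nonneg[OF L cont _ _ mid t]) (use m0 in auto)
  then show ?thesis using sL by (simp add: m_def f_def field_simps)
qed

end

theorem theoremB:
  fixes k :: real
    and X :: "'a set" and d :: "'a \<Rightarrow> 'a \<Rightarrow> real"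
    and p q r s :: 'a and G :: "'a set"
    and p' q' r' s' :: "real^3" and G' :: "(real^3) set"
  assumes "alexandrov_space k X d"
    and "Metric_space.mcomplete X d"
    and "p \<in> X"
    and "minimal_geodesic X d q r G"
    and "p' \<in> model_plane k"
    and "minimal_geodesic (model_plane k) (model_dist k) q' r' G'"
    and "model_dist k p' q' = d p q"
    and "model_dist k p' r' = d p r"
    and "model_dist k q' r' = d q r"
    and "k > 0 \<longrightarrow> d p q + d p r + d q r < 2 * pi / sqrt k"
    and "s \<in> G" and "s' \<in> G'"
    and "d q s = model_dist k q' s'"
  shows "d p s \<ge> model_dist k p' s'"
proof -
  have ls: "length_space X d" and lc: "locally_compact_space (Metric_space.mtopology X d)"
    using assms(1) by (auto simp: alexandrov_space_def)
  have ms: "Metric_space X d" using ls by (simp add: length_space_def)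
  interpret alexandrov X d k
    using ms assms(1,2) ls lc by (intro_locales) (auto simp: alexandrov_axioms_def complete_length_space_axioms_def)
  define t u where "t = d q s" and "u = d s r"
  note bet = minimal_geodesic_between[OF ms assms(4,11)]
  note bet' = minimal_geodesic_between[OF Metric_space_model_plane assms(6,12)]
  have t: "model_dist k q' s' = t" "model_dist k s' r' = u" "model_dist k q' r' = t + u" "d q r = t + u"
    using bet(4) bet'(4) assms by (auto simp: t_def u_def)
  have tu: "0 \<le> t" "0 \<le> u" by (auto simp: t_def u_def)
  interpret S: Metric_space "model_plane k" "model_dist k" by (rule Metric_space_model_plane)
  show ?thesis
  proof (cases "t + u = 0")
    case True
    then have "t = 0" using tu by simp
    then have "q = s" "q' = s'" using t(1) bet(1,3) bet'(1,3) zero S.zero by (simp_all add: t_def)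
    then show ?thesis using assms(7) by simp
  next
    case False
    then have L: "0 < t + u" using tu by simp
    have "d q r \<le> d p q + d p r" using triangle[of q p r] bet assms(3) by (simp add: commute)
    then have bd: "below_diam k (t + u)" using assms(10) t by (auto simp: below_diam_def simp flip: times_divide_eq_right)
    obtain g1 where g1: "geod X d g1 t" "g1 0 = q" "g1 t = s"
      using geodesic_exists[OF bet(1,3)] unfolding t_def by blast
    obtain g2 where g2: "geod X d g2 u" "g2 0 = s" "g2 u = r"
      using geodesic_exists[OF bet(3,2)] unfolding u_def by blast
    define g where "g v = (if v \<le> t then g1 v else g2 (v - t))" for v
    have g: "geod X d g (t + u)"
      unfolding g_def using g1 g2 t by (intro geod_append tu) auto
    have gv: "g 0 = q" "g t = s" "g (t + u) = r" using g1 g2 tu by (auto simp: g_def)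
    have "sn k u * (md k (d p q) - md k t) + sn k t * (md k (d p r) - md k u) \<le> sn k (t + u) * md k (d p s)"
      using four_point_global[OF assms(3) g L bd, of t] gv assms(10) t tu by simp
    moreover have "sn k (t + u) * md k (model_dist k p' s') =
      sn k u * (md k (d p q) - md k t) + sn k t * (md k (d p r) - md k u)"
      using model_four_point[OF assms(5) bet'(1,2,3) t(1,2,3) L bd] assms by simp
    ultimately have "sn k (t + u) * md k (model_dist k p' s') \<le> sn k (t + u) * md k (d p s)" by simp
    then have le: "md k (model_dist k p' s') \<le> md k (d p s)" using sn_pos[OF L bd] by simp
    show ?thesis
    proof (rule ccontr)
      assume "\<not> ?thesis"
      then have "md k (d p s) < md k (model_dist k p' s')"
        using model_dist_le by (intro md_strict_mono) auto
      then show False using le by simp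
    qed
  qed
qed

end
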